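(* Let $0<\alpha<1$, let $A,B$ be positive semidefinite $n\times n$ matrices, and let $\mathcal{M}_{\alpha,p}$ be any one of $\mathcal{A}_{\alpha,p}$, $\mathcal{H}_{\alpha,p}$, $G_{\alpha,p}$, $SG_{\alpha,p}$, $\widetilde{SG}_{\alpha,p}$, $R_{\alpha,p}$ (defined below), where in the cases $SG_{\alpha,p}$ and $\widetilde{SG}_{\alpha,p}$ it is additionally assumed that $s(A)\ge s(B)$. Then $$LE_\alpha(A,B)=\lim_{p\searrow0}\mathcal{M}_{\alpha,p}(A,B).$$
   Context: For positive semidefinite $A$: $s(A)$ is its support projection; $A^0:=s(A)$; $A^{-1}$ is the generalized inverse (inverse on the range of $s(A)$, zero on its complement), and $A^{-p}:=(A^{-1})^p$ for $p>0$; $\log A$ is the logarithm on the range of $s(A)$, zero on its complement. For positive definite $A,B$: $A\#_\alpha B:=A^{1/2}(A^{-1/2}BA^{-1/2})^\alpha A^{1/2}$, $A!_\alpha B:=((1-\alpha)A^{-1}+\alpha B^{-1})^{-1}$; for positive semidefinite $A,B$ these are extended by $A\#_\alpha B:=\lim_{\varepsilon\searrow0}(A+\varepsilon I)\#_\alpha(B+\varepsilon I)$ and likewise for $!_\alpha$; $\#:=\#_{1/2}$. For $p>0$ and positive semidefinite $A,B$: $\mathcal{A}_{\alpha,p}(A,B):=((1-\alpha)A^p+\alpha B^p)^{1/p}$; $\mathcal{H}_{\alpha,p}(A,B):=(A^p!_\alpha B^p)^{1/p}$; $G_{\alpha,p}(A,B):=(A^p\#_\alpha B^p)^{1/p}$;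 $SG_{\alpha,p}(A,B):=\{(A^{-p}\#B^p)^\alpha A^p(A^{-p}\#B^p)^\alpha\}^{1/p}$; $\widetilde{SG}_{\alpha,p}(A,B):=\{(A^{-p}\#_\alpha B^p)^{1/2}A^{2(1-\alpha)p}(A^{-p}\#_\alpha B^p)^{1/2}\}^{1/p}$; $R_{\alpha,p}(A,B):=(A^{\frac{1-\alpha}{2}p}B^{\alpha p}A^{\frac{1-\alpha}{2}p})^{1/p}$; and $LE_\alpha(A,B):=P_0\exp\{(1-\alpha)P_0(\log A)P_0+\alpha P_0(\log B)P_0\}$ with $P_0:=s(A)\wedge s(B)$ (projection onto the intersection of ranges). *)

theory Defs
  imports "HOL-Analysis.Analysis"
begin

text \<open>Complex n x n matrices are modelled as complex^'n^'n with a finite index type 'n.\<close>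

type_synonym 'n cmat = "complex^'n^'n"

definition madj :: "'n::finite cmat \<Rightarrow> 'n cmat" where
  "madj M = (\<chi> i j. cnj (M $ j $ i))"

definition hermitian :: "'n::finite cmat \<Rightarrow> bool" where
  "hermitian M \<longleftrightarrow> madj M = M"

definition unitary :: "'n::finite cmat \<Rightarrow> bool" where
  "unitary U \<longleftrightarrow> madj U ** U = mat 1"

definition psd :: "'n::finite cmat \<Rightarrow> bool" where
  "psd M \<longleftrightarrow> hermitian M \<and>
     (\<forall>v::complex^'n. 0 \<le> Re (\<Sum>i\<in>UNIV. cnj (v $ i) * (M *v v) $ i))"

definition diagm :: "('n::finite \<Rightarrow> complex) \<Rightarrow> 'n cmat" where
  "diagm d = (\<chi> i j. if i = j then d i else 0)"

text \<open>Functional calculus for Hermitian matrices: f(A) = U f(D) U^* where A = U D U^*.\<close>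
definition matfun :: "(real \<Rightarrow> real) \<Rightarrow> 'n::finite cmat \<Rightarrow> 'n cmat" where
  "matfun f A = (THE B. \<exists>U (d::'n \<Rightarrow> real). unitary U \<and>
        A = U ** diagm (\<lambda>i. complex_of_real (d i)) ** madj U \<and>
        B = U ** diagm (\<lambda>i. complex_of_real (f (d i))) ** madj U)"

text \<open>Support projection s(A).\<close>
definition supp :: "'n::finite cmat \<Rightarrow> 'n cmat" where
  "supp A = matfun (\<lambda>x. if x = 0 then 0 else 1) A"

text \<open>Generalized inverse A^{-1}.\<close>
definition ginv :: "'n::finite cmat \<Rightarrow> 'n cmat" where
  "ginv A = matfun (\<lambda>x. if x = 0 then 0 else 1 / x) A"

text \<open>A^p for p > 0 (with 0^p = 0).\<close>
definition mpow :: "'n::finite cmat \<Rightarrow> real \<Rightarrow> 'n cmat" where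
  "mpow A p = matfun (\<lambda>x. x powr p) A"

text \<open>A^{-p} := (A^{-1})^p.\<close>
definition mnpow :: "'n::finite cmat \<Rightarrow> real \<Rightarrow> 'n cmat" where
  "mnpow A p = mpow (ginv A) p"

text \<open>log A on the range of s(A), zero on its complement.\<close>
definition mlog :: "'n::finite cmat \<Rightarrow> 'n cmat" where
  "mlog A = matfun (\<lambda>x. if x = 0 then 0 else ln x) A"

definition mexp :: "'n::finite cmat \<Rightarrow> 'n cmat" where
  "mexp H = matfun exp H"

text \<open>Orthogonal projection onto the intersection of the ranges of two projections.\<close>
definition proj_meet :: "'n::finite cmat \<Rightarrow> 'n cmat \<Rightarrow> 'n cmat" where
  "proj_meet P Q = (THE R. hermitian R \<and> R ** R = R \<and>
      range ((*v) R) = range ((*v) P) \<inter> range ((*v) Q))"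

text \<open>Weighted geometric mean for positive definite matrices, and its extension.\<close>
definition gmean_pd :: "real \<Rightarrow> 'n::finite cmat \<Rightarrow> 'n cmat \<Rightarrow> 'n cmat" where
  "gmean_pd \<alpha> A B = mpow A (1/2) ** mpow (mnpow A (1/2) ** B ** mnpow A (1/2)) \<alpha> ** mpow A (1/2)"

definition gmean :: "real \<Rightarrow> 'n::finite cmat \<Rightarrow> 'n cmat \<Rightarrow> 'n cmat" where
  "gmean \<alpha> A B = Lim (at_right 0) (\<lambda>e::real. gmean_pd \<alpha> (A + e *\<^sub>R mat 1) (B + e *\<^sub>R mat 1))"

text \<open>Weighted harmonic mean for positive definite matrices, and its extension.\<close>
definition hmean_pd :: "real \<Rightarrow> 'n::finite cmat \<Rightarrow> 'n cmat \<Rightarrow> 'n cmat" where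
  "hmean_pd \<alpha> A B = ginv ((1 - \<alpha>) *\<^sub>R ginv A + \<alpha> *\<^sub>R ginv B)"

definition hmean :: "real \<Rightarrow> 'n::finite cmat \<Rightarrow> 'n cmat \<Rightarrow> 'n cmat" where
  "hmean \<alpha> A B = Lim (at_right 0) (\<lambda>e::real. hmean_pd \<alpha> (A + e *\<^sub>R mat 1) (B + e *\<^sub>R mat 1))"

definition meanA :: "real \<Rightarrow> real \<Rightarrow> 'n::finite cmat \<Rightarrow> 'n cmat \<Rightarrow> 'n cmat" where
  "meanA \<alpha> p A B = mpow ((1 - \<alpha>) *\<^sub>R mpow A p + \<alpha> *\<^sub>R mpow B p) (1/p)"

definition meanH :: "real \<Rightarrow> real \<Rightarrow> 'n::finite cmat \<Rightarrow> 'n cmat \<Rightarrow> 'n cmat" where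
  "meanH \<alpha> p A B = mpow (hmean \<alpha> (mpow A p) (mpow B p)) (1/p)"

definition meanG :: "real \<Rightarrow> real \<Rightarrow> 'n::finite cmat \<Rightarrow> 'n cmat \<Rightarrow> 'n cmat" where
  "meanG \<alpha> p A B = mpow (gmean \<alpha> (mpow A p) (mpow B p)) (1/p)"

definition meanSG :: "real \<Rightarrow> real \<Rightarrow> 'n::finite cmat \<Rightarrow> 'n cmat \<Rightarrow> 'n cmat" where
  "meanSG \<alpha> p A B =
     (let C = gmean (1/2) (mnpow A p) (mpow B p)
      in mpow (mpow C \<alpha> ** mpow A p ** mpow C \<alpha>) (1/p))"

definition meanSGt :: "real \<Rightarrow> real \<Rightarrow> 'n::finite cmat \<Rightarrow> 'n cmat \<Rightarrow> 'n cmat" where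
  "meanSGt \<alpha> p A B =
     (let C = gmean \<alpha> (mnpow A p) (mpow B p)
      in mpow (mpow C (1/2) ** mpow A (2 * (1 - \<alpha>) * p) ** mpow C (1/2)) (1/p))"

definition meanR :: "real \<Rightarrow> real \<Rightarrow> 'n::finite cmat \<Rightarrow> 'n cmat \<Rightarrow> 'n cmat" where
  "meanR \<alpha> p A B = mpow (mpow A ((1 - \<alpha>) / 2 * p) ** mpow B (\<alpha> * p) ** mpow A ((1 - \<alpha>) / 2 * p)) (1/p)"

text \<open>Log-Euclidean mean LE_alpha(A,B).\<close>
definition LE :: "real \<Rightarrow> 'n::finite cmat \<Rightarrow> 'n cmat \<Rightarrow> 'n cmat" where
  "LE \<alpha> A B = (let P0 = proj_meet (supp A) (supp B)
     in P0 ** mexp ((1 - \<alpha>) *\<^sub>R (P0 ** mlog A ** P0) + \<alpha> *\<^sub>R (P0 ** mlog B ** P0)))"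

end

theory Submission
  imports Defs
begin

text \<open>
  Every mean is \<open>X p\<close> to the power \<open>1 / p\<close>, where \<open>X p = S + p D + o(p)\<close> is positive
  semidefinite, \<open>S \<le> 1\<close>, and the eigenspace of \<open>S\<close> for the eigenvalue 1 is the intersection
  of the ranges of \<open>s(A)\<close> and \<open>s(B)\<close>, with projection \<open>P\<close>. Degenerate first-order perturbation
  theory gives the limit \<open>P exp(P D P)\<close>, and \<open>P D P\<close> is the exponent of the Log-Euclidean mean.
  For the arithmetic mean and for \<open>R\<close> the expansion is the product rule applied to
  \<open>A\<^sup>p = s(A) + p log A + o(p)\<close>. The geometric and harmonic means of \<open>A\<^sup>p\<close> and \<open>B\<^sup>p\<close> live on the
  range of \<open>P\<close>, where they lie between \<open>2P\<close> minus the compressed average of the inverses and the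
  compressed arithmetic mean; both have the same expansion to first order. The spectral
  geometric means are products of powers of such geometric means and of powers of \<open>A\<close>.
\<close>

subsection \<open>The spectral theorem\<close>

text \<open>The power \<open>1 / p\<close> turns an eigenvalue \<open>1 + p * m + o(p)\<close> into
  \<open>exp m\<close> in the limit, so convergence of \<open>X p\<close> alone is not enough;
  errors have to be \<open>o(p)\<close>. Since the eigenvalue 1 of \<open>S\<close> may split for
  \<open>p > 0\<close>, no eigenbasis depending continuously on \<open>p\<close> is at hand;
  compactness of the unitary group and subsequences replace it.

  The second obstacle is a double limit. For singular matrices the geometric and harmonic means are
  themselves limits of regularized means, one limit for every \<open>p\<close>, and no rate uniform
  in \<open>p\<close> is available. So the inner limit is described only by properties that survive
  it: vanishing on both kernels, an upper bound and a lower bound. These determine the outer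
  expansion, because \<open>A^p\<close> and \<open>A^(-p)\<close> have opposite slopes at
  \<open>p = 0\<close> and \<open>2 - x\<close> is the tangent of \<open>1 / x\<close> at 1.
  Compression to the range of \<open>P\<close> cannot be skipped: the arithmetic mean itself tends
  to a convex combination of the two support projections, which in general is not
  \<open>P\<close>.\<close>

definition cip :: "complex^'n::finite \<Rightarrow> complex^'n \<Rightarrow> complex" where
  "cip x y = (\<Sum>i\<in>UNIV. cnj (x $ i) * y $ i)"

text \<open>Spans, dimension and continuity are tied to the real inner product
  \<open>\<bullet>\<close>, unitarity to the complex \<open>cip\<close>; this identity passes from
  one to the other.\<close>

lemma inner_eq_Re_cip: "x \<bullet> y = Re (cip x y)"
  by (simp add: cip_def inner_vec_def inner_complex_def)

lemma cip_self: "cip x x = of_real (x \<bullet> x)"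
proof -
  have "cnj z * z = of_real (z \<bullet> z)" for z :: complex
    by (simp add: complex_eq_iff inner_complex_def)
  then show ?thesis by (simp add: cip_def inner_vec_def)
qed

lemma cip_add_right: "cip x (y + z) = cip x y + cip x z"
  by (simp add: cip_def distrib_left sum.distrib)

lemma cip_smult_right: "cip x (c *s y) = c * cip x y"
  by (simp add: cip_def sum_distrib_left mult_ac)

lemma cip_smult_left: "cip (c *s x) y = cnj c * cip x y"
  by (simp add: cip_def sum_distrib_left mult_ac)

lemma cip_commute: "cip y x = cnj (cip x y)"
  by (simp add: cip_def mult_ac)

lemma cip_madj: "cip (A *v x) y = cip x (madj A *v y)"
proof -
  have "cip (A *v x) y = (\<Sum>i\<in>UNIV. \<Sum>j\<in>UNIV. cnj (A$i$j) * cnj (x$j) * y$i)"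
    by (simp add: cip_def matrix_vector_mult_def sum_distrib_right)
  also have "\<dots> = (\<Sum>j\<in>UNIV. \<Sum>i\<in>UNIV. cnj (A$i$j) * cnj (x$j) * y$i)"
    by (rule sum.swap)
  also have "\<dots> = cip x (madj A *v y)"
    by (simp add: cip_def matrix_vector_mult_def madj_def sum_distrib_left mult_ac)
  finally show ?thesis .
qed

lemma inner_madj: "(A *v x) \<bullet> y = x \<bullet> (madj A *v y)"
  by (simp add: inner_eq_Re_cip cip_madj)

lemma bounded_bilinear_matrix_mult:
  "bounded_bilinear ((**) :: complex^'n::finite^'n \<Rightarrow> complex^'n^'n \<Rightarrow> complex^'n^'n)"
  unfolding bilinear_conv_bounded_bilinear[symmetric] bilinear_def linear_iff
  by (simp add: matrix_add_ldistrib matrix_matrix_mult_def vec_eq_iff algebra_simps sum.distrib scaleR_sum_right)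

lemma bounded_bilinear_matrix_vector_mult:
  "bounded_bilinear ((*v) :: complex^'n::finite^'n \<Rightarrow> complex^'n \<Rightarrow> complex^'n)"
  unfolding bilinear_conv_bounded_bilinear[symmetric] bilinear_def linear_iff
  by (simp add: matrix_vector_mult_def vec_eq_iff algebra_simps sum.distrib scaleR_sum_right)

interpretation mm: bounded_bilinear "(**) :: complex^'n::finite^'n \<Rightarrow> complex^'n^'n \<Rightarrow> complex^'n^'n"
  by (rule bounded_bilinear_matrix_mult)

interpretation mv: bounded_bilinear "(*v) :: complex^'n::finite^'n \<Rightarrow> complex^'n \<Rightarrow> complex^'n"
  by (rule bounded_bilinear_matrix_vector_mult)

lemma madj_madj [simp]: "madj (madj A) = A"
  by (simp add: madj_def vec_eq_iff)

lemma madj_mult [simp]: "madj (A ** B) = madj B ** madj A"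
  by (simp add: madj_def vec_eq_iff matrix_matrix_mult_def mult_ac)

lemma madj_add [simp]: "madj (A + B) = madj A + madj B"
  by (simp add: madj_def vec_eq_iff)

lemma madj_diff [simp]: "madj (A - B) = madj A - madj B"
  by (simp add: madj_def vec_eq_iff)

lemma madj_scaleR [simp]: "madj (c *\<^sub>R A) = c *\<^sub>R madj A"
  by (simp add: madj_def vec_eq_iff)

lemma madj_mat1 [simp]: "madj (mat 1) = mat 1"
  by (auto simp add: madj_def vec_eq_iff mat_def)

lemma madj_diagm_real [simp]: "madj (diagm (\<lambda>i. complex_of_real (d i))) = diagm (\<lambda>i. complex_of_real (d i))"
  by (auto simp add: madj_def vec_eq_iff diagm_def)

lemma diagm_mult_nth: "(diagm d ** M) $ i $ j = d i * M $ i $ j"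
  by (simp add: diagm_def matrix_matrix_mult_def if_distrib if_distribR sum.delta' cong: if_cong)

lemma mult_diagm_nth: "(M ** diagm d) $ i $ j = M $ i $ j * d j"
  by (simp add: diagm_def matrix_matrix_mult_def if_distrib if_distribR sum.delta' cong: if_cong)

lemma diagm_mult: "diagm d ** diagm e = diagm (\<lambda>i. d i * e i)"
  by (simp add: vec_eq_iff diagm_mult_nth) (simp add: diagm_def)

lemma diagm_add: "diagm d + diagm e = diagm (\<lambda>i. d i + e i)"
  by (simp add: vec_eq_iff diagm_def)

lemma diagm_diff: "diagm d - diagm e = diagm (\<lambda>i. d i - e i)"
  by (simp add: vec_eq_iff diagm_def)

lemma diagm_scaleR: "c *\<^sub>R diagm d = diagm (\<lambda>i. c *\<^sub>R d i)"
  by (simp add: vec_eq_iff diagm_def)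

lemma diagm_1: "diagm (\<lambda>i. 1) = mat 1"
  by (simp add: vec_eq_iff diagm_def mat_def)

lemma hermitian_inner: "hermitian A \<Longrightarrow> (A *v x) \<bullet> y = x \<bullet> (A *v y)"
  by (simp add: inner_madj hermitian_def)

lemma psd_iff: "psd M \<longleftrightarrow> hermitian M \<and> (\<forall>v. 0 \<le> v \<bullet> (M *v v))"
  unfolding psd_def by (simp add: inner_eq_Re_cip cip_def)

text \<open>Each vector is accompanied by its multiple by \<open>\<i>\<close>: real orthogonality to
  both is complex orthogonality to one. The count works because \<open>2 * card J\<close> is below
  the real dimension \<open>2 * CARD('n)\<close>.\<close>

lemma orthogonal_family_complement:
  fixes u :: "'n::finite \<Rightarrow> complex^'n"
  assumes "J \<noteq> UNIV"
  shows "\<exists>x. x \<noteq> 0 \<and> (\<forall>j\<in>J. cip (u j) x = 0)"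
proof -
  let ?S = "u ` J \<union> (\<lambda>j. \<i> *s u j) ` J"
  have J: "card J < CARD('n)"
    using assms by (metis card_seteq finite_UNIV finite_code linorder_not_less subset_UNIV)
  have "dim ?S \<le> card ?S" by (intro dim_le_card') auto
  also have "\<dots> \<le> card (u ` J) + card ((\<lambda>j. \<i> *s u j) ` J)" by (rule card_Un_le)
  also have "\<dots> \<le> card J + card J" by (intro add_mono card_image_le) auto
  also have "\<dots> < DIM(complex^'n)" using J by simp
  finally obtain x where x: "x \<noteq> 0" "\<And>y. y \<in> span ?S \<Longrightarrow> orthogonal x y"
    using orthogonal_to_subspace_exists by blast
  have "cip (u j) x = 0" if "j \<in> J" for j
  proof -
    have a: "x \<bullet> u j = 0" "x \<bullet> (\<i> *s u j) = 0"
      using x(2)[OF span_base, of "u j"] x(2)[OF span_base, of "\<i> *s u j"] that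
      by (auto simp: orthogonal_def)
    then have "Re (cip (u j) x) = 0" "Re (cip (\<i> *s u j) x) = 0"
      by (simp_all add: inner_eq_Re_cip[symmetric] inner_commute)
    then show ?thesis by (simp add: cip_smult_left complex_eq_iff)
  qed
  with x(1) show ?thesis by blast
qed

lemma hermitian_eigenvector_in_subspace:
  fixes A :: "complex^'n::finite^'n" and u :: "'n \<Rightarrow> complex^'n"
  assumes A: "hermitian A" and u: "\<And>j. j \<in> J \<Longrightarrow> A *v u j = of_real (d j) *s u j"
    and "J \<noteq> UNIV"
  shows "\<exists>x l. cip x x = 1 \<and> (\<forall>j\<in>J. cip (u j) x = 0) \<and> A *v x = of_real l *s x"
proof -
  define W where "W = {x. \<forall>j\<in>J. cip (u j) x = 0}"
  have W: "c *\<^sub>R x + y \<in> W" if "x \<in> W" "y \<in> W" for c x y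
  proof -
    have "c *\<^sub>R x = complex_of_real c *s x" by (simp add: vec_eq_iff scaleR_conv_of_real[where 'a=complex])
    then show ?thesis using that by (simp add: W_def cip_add_right cip_smult_right)
  qed
  have WA: "A *v x \<in> W" if "x \<in> W" for x
  proof -
    have "cip (u j) (A *v x) = cip (A *v u j) x" if "j \<in> J" for j
      using A by (simp add: cip_madj hermitian_def)
    then show ?thesis using that u by (simp add: W_def cip_smult_left)
  qed
  \<comment> \<open>Writes \<open>cip\<close> through real inner products, for which continuity, and
    hence closedness of \<open>W\<close>, is immediate.\<close>
  have sc: "cip (v::complex^'n) x = (v \<bullet> x) + \<i> * ((\<i> *s v) \<bullet> x)" for v x
    by (simp add: inner_eq_Re_cip cip_smult_left complex_eq_iff)
  have "closed W"
    unfolding W_def sc Ball_def by (intro closed_Collect_all closed_Collect_imp open_Collect_const closed_Collect_eq continuous_intros)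
  then have comp: "compact (W \<inter> sphere 0 1)"
    by (intro closed_Int_compact) auto
  obtain x0 where x0: "x0 \<noteq> 0" "x0 \<in> W"
    using orthogonal_family_complement[OF \<open>J \<noteq> UNIV\<close>, of u] by (auto simp: W_def)
  have "(1 / norm x0) *\<^sub>R x0 + 0 \<in> W" by (rule W) (use x0 in \<open>auto simp: W_def cip_def\<close>)
  then have "(1 / norm x0) *\<^sub>R x0 \<in> W \<inter> sphere 0 1" using x0 by simp
  then have ne: "W \<inter> sphere 0 1 \<noteq> {}" by blast
  have "continuous_on (W \<inter> sphere 0 1) (\<lambda>x. x \<bullet> (A *v x))"
    by (intro continuous_intros mv.continuous_on)
  \<comment> \<open>A maximiser of the quadratic form on the unit sphere of the invariant subspace is an eigenvector.\<close>
  from continuous_attains_sup[OF comp ne this] obtain x where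
    x: "x \<in> W" "norm x = 1" and max: "\<And>y. y \<in> W \<Longrightarrow> norm y = 1 \<Longrightarrow> y \<bullet> (A *v y) \<le> x \<bullet> (A *v x)"
    by auto
  define l where "l = x \<bullet> (A *v x)"
  have max': "y \<bullet> (A *v y) \<le> l * (y \<bullet> y)" if "y \<in> W" for y
  proof (cases "y = 0")
    case False
    define c where "c = 1 / norm y"
    have "c *\<^sub>R y + 0 \<in> W" by (rule W) (use that in \<open>auto simp: W_def cip_def\<close>)
    then have "(c *\<^sub>R y) \<bullet> (A *v (c *\<^sub>R y)) \<le> l"
      unfolding l_def using False by (intro max) (auto simp: c_def)
    then have "c * c * (y \<bullet> (A *v y)) \<le> l" by (simp add: mv.scaleR_right)
    then show ?thesis using False
      by (simp add: c_def dot_square_norm field_simps power2_eq_square)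
  qed auto
  \<comment> \<open>The residual of the eigenvalue equation, which is half the gradient at
    \<open>x\<close> of \<open>y \<bullet> (A *v y) - l * (y \<bullet> y)\<close>. Moving from
    \<open>x\<close> along \<open>g\<close> would raise this form above its maximum 0 unless
    \<open>g = 0\<close>.\<close>
  define g where "g = A *v x - l *\<^sub>R x"
  have gW: "g \<in> W" using W[of x "A *v x" "-l"] WA x(1) by (simp add: g_def)
  define c where "c = l * (g \<bullet> g) - g \<bullet> (A *v g)"
  have c0: "c \<ge> 0" using max'[OF gW] by (simp add: c_def)
  have key: "2 * t * (g \<bullet> g) \<le> t * t * c" for t
  proof -
    have "t *\<^sub>R g + x \<in> W" by (rule W[OF gW x(1)])
    from max'[OF this] have "t * t * (g \<bullet> (A *v g)) + t * (g \<bullet> (A *v x)) + t * (x \<bullet> (A *v g)) + l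
       \<le> l * (t * t * (g \<bullet> g) + 2 * t * (g \<bullet> x) + x \<bullet> x)"
      by (simp add: mv.add_right mv.scaleR_right inner_add_left inner_add_right l_def algebra_simps inner_commute)
    moreover have "x \<bullet> (A *v g) = g \<bullet> (A *v x)"
      using hermitian_inner[OF A, of x g] by (simp add: inner_commute)
    moreover have "x \<bullet> x = 1" using x(2) by (simp add: dot_square_norm)
    moreover have "g \<bullet> (A *v x) = g \<bullet> g + l * (g \<bullet> x)"
      by (simp add: g_def algebra_simps)
    ultimately show ?thesis by (simp add: c_def algebra_simps)
  qed
  have "g \<bullet> g = 0"
  proof (rule ccontr)
    assume "g \<bullet> g \<noteq> 0"
    then have G: "g \<bullet> g > 0" by simp
    \<comment> \<open>Small enough that the second-order term \<open>t * c\<close> stays below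
      \<open>g \<bullet> g\<close>; the \<open>+ 1\<close> covers \<open>c = 0\<close>.\<close>
    define t where "t = (g \<bullet> g) / (c + 1)"
    have t: "t > 0" using G c0 by (simp add: t_def)
    have "2 * (g \<bullet> g) \<le> t * c" using key[of t] t by (simp add: mult.assoc)
    also have "t * c \<le> g \<bullet> g" using G c0 by (simp add: t_def field_simps)
    finally show False using G by simp
  qed
  then have "A *v x = of_real l *s x"
    by (simp add: g_def vec_eq_iff scaleR_conv_of_real[where 'a=complex])
  moreover have "cip x x = 1" using x(2) by (simp add: cip_self dot_square_norm)
  ultimately show ?thesis using x(1) by (auto simp: W_def)
qed

lemma hermitian_orthonormal_eigenvectors:
  fixes A :: "complex^'n::finite^'n"
  assumes A: "hermitian A"
  shows "\<exists>(u :: 'n \<Rightarrow> complex^'n) d. (\<forall>i\<in>J. \<forall>j\<in>J. cip (u i) (u j) = (if i = j then 1 else 0)) \<and>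
           (\<forall>j\<in>(J::'n set). A *v u j = of_real (d j) *s u j)"
  using finite[of J]
proof (induction J rule: finite_induct)
  case (insert a J)
  then obtain u :: "'n \<Rightarrow> complex^'n" and d where ud: "\<forall>i\<in>J. \<forall>j\<in>J. cip (u i) (u j) = (if i = j then 1 else 0)"
    "\<forall>j\<in>J. A *v u j = of_real (d j) *s u j" by blast
  have "J \<noteq> UNIV" using insert by auto
  from hermitian_eigenvector_in_subspace[OF A _ this, of u d] ud obtain x l where
    x: "cip x x = 1" "\<forall>j\<in>J. cip (u j) x = 0" "A *v x = of_real l *s x" by blast
  have x': "\<forall>j\<in>J. cip x (u j) = 0" using x(2) by (metis cip_commute complex_cnj_zero)
  show ?case
    by (rule exI[of _ "u(a := x)"], rule exI[of _ "d(a := l)"])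
      (use ud x x' insert in auto)
qed auto

lemma unitary_right: "unitary U \<Longrightarrow> U ** madj U = mat 1"
  by (simp add: unitary_def matrix_left_right_inverse)

lemma hermitian_diagonalization:
  fixes A :: "complex^'n::finite^'n"
  assumes A: "hermitian A"
  obtains U d where "unitary U" "A = U ** diagm (\<lambda>i. complex_of_real (d i)) ** madj U"
proof -
  obtain u :: "'n \<Rightarrow> complex^'n" and d where u: "\<forall>i j. cip (u i) (u j) = (if i = j then 1 else 0)"
    and d: "\<forall>j. A *v u j = of_real (d j) *s u j"
    using hermitian_orthonormal_eigenvectors[OF A, of UNIV] by auto
  define U where "U = (\<chi> i j. u j $ i)"
  have U: "unitary U"
    using u by (simp add: unitary_def vec_eq_iff U_def madj_def matrix_matrix_mult_def cip_def mat_def)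
  have "(A ** U) $ i $ j = (U ** diagm (\<lambda>i. complex_of_real (d i))) $ i $ j" for i j
  proof -
    have "(A ** U) $ i $ j = (A *v u j) $ i"
      by (simp add: matrix_matrix_mult_def matrix_vector_mult_def U_def)
    then show ?thesis using d by (simp add: mult_diagm_nth U_def mult.commute)
  qed
  then have "A ** U = U ** diagm (\<lambda>i. complex_of_real (d i))" by (simp add: vec_eq_iff)
  then have "A = U ** diagm (\<lambda>i. complex_of_real (d i)) ** madj U"
    by (metis U matrix_mul_assoc matrix_mul_rid unitary_right)
  with U that show ?thesis by blast
qed

subsection \<open>Functional calculus\<close>

abbreviation (input) sdiag :: "'n::finite cmat \<Rightarrow> ('n \<Rightarrow> real) \<Rightarrow> 'n cmat" where
  "sdiag U d \<equiv> U ** diagm (\<lambda>i. complex_of_real (d i)) ** madj U"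

lemma unitary_left: "unitary U \<Longrightarrow> madj U ** U = mat 1"
  by (simp add: unitary_def)

lemma unitary_cancel:
  assumes "unitary U"
  shows "madj U ** (U ** M) = M" "U ** (madj U ** M) = M"
  using assms by (simp_all add: matrix_mul_assoc unitary_left unitary_right)

lemma unitary_mult: "unitary U \<Longrightarrow> unitary V \<Longrightarrow> unitary (U ** V)"
  by (simp add: unitary_def matrix_mul_assoc[symmetric] unitary_cancel)

text \<open>Justifies the definite description in \<open>matfun\<close>: the result does not depend
  on the chosen diagonalization. From here on, matrix identities for functions of one matrix reduce
  to scalar ones.\<close>

lemma matfun_sdiag:
  fixes U :: "'n::finite cmat"
  assumes U: "unitary U"
  shows "matfun f (sdiag U d) = sdiag U (\<lambda>i. f (d i))"
proof -
  have uniq: "sdiag V (\<lambda>i. f (e i)) = sdiag U (\<lambda>i. f (d i))"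
    if V: "unitary V" and eq: "sdiag U d = sdiag V e" for V :: "'n cmat" and e
  proof -
    \<comment> \<open>\<open>W\<close> intertwines the two diagonal matrices, so it only links equal eigenvalues.\<close>
    define W where "W = madj V ** U"
    have "W ** diagm (\<lambda>i. complex_of_real (d i)) = madj V ** sdiag U d ** U"
      using U by (simp add: W_def matrix_mul_assoc[symmetric] unitary_cancel unitary_left)
    also have "\<dots> = diagm (\<lambda>i. complex_of_real (e i)) ** W"
      unfolding eq using V by (simp add: W_def matrix_mul_assoc[symmetric] unitary_cancel unitary_left)
    finally have "W $ i $ j * complex_of_real (d j) = complex_of_real (e i) * W $ i $ j" for i j
      by (metis diagm_mult_nth mult_diagm_nth)
    then have "W $ i $ j = 0 \<or> d j = e i" for i j by (metis mult.commute mult_cancel_left of_real_eq_iff)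
    then have "W $ i $ j * complex_of_real (f (d j)) = complex_of_real (f (e i)) * W $ i $ j" for i j
      by (metis mult.commute mult_zero_left)
    then have *: "W ** diagm (\<lambda>i. complex_of_real (f (d i))) = diagm (\<lambda>i. complex_of_real (f (e i))) ** W"
      by (simp add: vec_eq_iff diagm_mult_nth mult_diagm_nth)
    have "sdiag U (\<lambda>i. f (d i)) = V ** (W ** diagm (\<lambda>i. complex_of_real (f (d i)))) ** madj U"
      using V by (simp add: W_def matrix_mul_assoc[symmetric] unitary_cancel)
    also have "\<dots> = sdiag V (\<lambda>i. f (e i))"
      using U unfolding * by (simp add: W_def matrix_mul_assoc[symmetric] unitary_right)
    finally show ?thesis by simp
  qed
  show ?thesis
    unfolding matfun_def
    by (rule the_equality) (use U uniq in blast)+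
qed

lemma hermitian_sdiag [simp]: "hermitian (sdiag U d)"
  by (simp add: hermitian_def matrix_mul_assoc)

lemma hermitian_matfun [simp]: "hermitian A \<Longrightarrow> hermitian (matfun f A)"
  by (metis hermitian_diagonalization hermitian_sdiag matfun_sdiag)

lemma sdiag_mult: "unitary U \<Longrightarrow> sdiag U d ** sdiag U e = sdiag U (\<lambda>i. d i * e i)"
  by (simp add: matrix_mul_assoc[symmetric] unitary_cancel)
    (simp add: matrix_mul_assoc diagm_mult)

lemma sdiag_add: "sdiag U d + sdiag U e = sdiag U (\<lambda>i. d i + e i)"
  by (simp add: mm.add_left[symmetric] mm.add_right[symmetric] diagm_add)

lemma sdiag_diff: "sdiag U d - sdiag U e = sdiag U (\<lambda>i. d i - e i)"
  by (simp add: mm.diff_left[symmetric] mm.diff_right[symmetric] diagm_diff)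

lemma sdiag_scaleR: "c *\<^sub>R sdiag U d = sdiag U (\<lambda>i. c * d i)"
proof -
  have "diagm (\<lambda>i. complex_of_real (c * d i)) = c *\<^sub>R diagm (\<lambda>i. complex_of_real (d i))"
    by (simp add: diagm_scaleR scaleR_conv_of_real[where 'a=complex])
  then show ?thesis by (simp only: mm.scaleR_left mm.scaleR_right)
qed

lemma sdiag_1: "unitary U \<Longrightarrow> sdiag U (\<lambda>i. 1) = mat 1"
  by (simp add: diagm_1 unitary_right)

lemma matfun_mult: "hermitian A \<Longrightarrow> matfun f A ** matfun g A = matfun (\<lambda>x. f x * g x) A"
  by (erule hermitian_diagonalization) (simp only: matfun_sdiag sdiag_mult)

lemma matfun_add: "hermitian A \<Longrightarrow> matfun f A + matfun g A = matfun (\<lambda>x. f x + g x) A"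
  by (erule hermitian_diagonalization) (simp only: matfun_sdiag sdiag_add)

lemma matfun_diff: "hermitian A \<Longrightarrow> matfun f A - matfun g A = matfun (\<lambda>x. f x - g x) A"
  by (erule hermitian_diagonalization) (simp only: matfun_sdiag sdiag_diff)

lemma matfun_scaleR: "hermitian A \<Longrightarrow> c *\<^sub>R matfun f A = matfun (\<lambda>x. c * f x) A"
  by (erule hermitian_diagonalization) (simp only: matfun_sdiag sdiag_scaleR)

lemma matfun_compose: "hermitian A \<Longrightarrow> matfun f (matfun g A) = matfun (\<lambda>x. f (g x)) A"
  by (erule hermitian_diagonalization) (simp only: matfun_sdiag)

lemma matfun_ident: "hermitian A \<Longrightarrow> matfun (\<lambda>x. x) A = A"
  by (erule hermitian_diagonalization) (simp only: matfun_sdiag)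

lemma matfun_one: "hermitian A \<Longrightarrow> matfun (\<lambda>x. 1) A = mat 1"
  by (erule hermitian_diagonalization) (simp only: matfun_sdiag sdiag_1)

lemma matfun_zero: "hermitian A \<Longrightarrow> matfun (\<lambda>x. 0) A = 0"
  using matfun_scaleR[of A 0 "\<lambda>x. 0"] by simp

lemma matfun_unitary_conj:
  assumes "unitary V" "hermitian Z"
  shows "matfun f (V ** Z ** madj V) = V ** matfun f Z ** madj V"
proof -
  obtain U d where U: "unitary U" "Z = sdiag U d" using hermitian_diagonalization[OF assms(2)] .
  have "V ** sdiag U e ** madj V = sdiag (V ** U) e" for e
    by (simp add: matrix_mul_assoc)
  then show ?thesis using matfun_sdiag[OF unitary_mult[OF assms(1) U(1)]] U by (simp add: matfun_sdiag)
qed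

lemma diagm_mult_vec_nth: "(diagm e *v w) $ i = e i * w $ i"
  by (simp add: matrix_vector_mult_def diagm_def if_distrib if_distribR sum.delta' cong: if_cong)

text \<open>The coordinates of \<open>v\<close> in an eigenbasis vanish wherever
  \<open>d i \<noteq> c\<close>, so \<open>v\<close> need not belong to the basis. This carries
  kernels and fixed vectors of a matrix over to its functions.\<close>

lemma eigenvector_matfun:
  assumes A: "hermitian A" and v: "A *v v = c *\<^sub>R v"
  shows "matfun f A *v v = f c *\<^sub>R v"
proof -
  obtain U d where U: "unitary U" "A = sdiag U d" using hermitian_diagonalization[OF A] .
  define w where "w = madj U *v v"
  have vw: "v = U *v w" using U by (simp add: w_def matrix_vector_mul_assoc unitary_right)
  have "diagm (\<lambda>i. complex_of_real (d i)) *v w = madj U *v (A *v v)"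
    using U by (simp add: w_def matrix_vector_mul_assoc matrix_mul_assoc unitary_left)
  also have "\<dots> = c *\<^sub>R w" by (simp add: v mv.scaleR_right w_def)
  finally have "complex_of_real (d i) * w $ i = complex_of_real c * w $ i" for i
    by (metis diagm_mult_vec_nth scaleR_conv_of_real[where 'a=complex] vector_scaleR_component)
  then have "w $ i = 0 \<or> d i = c" for i by auto
  then have "diagm (\<lambda>i. complex_of_real (f (d i))) *v w = f c *\<^sub>R w"
    by (auto simp: vec_eq_iff diagm_mult_vec_nth scaleR_conv_of_real[where 'a=complex])
  then have "U *v (diagm (\<lambda>i. complex_of_real (f (d i))) *v w) = f c *\<^sub>R v"
    by (simp add: mv.scaleR_right vw)
  then show ?thesis using U by (simp add: matfun_sdiag matrix_vector_mul_assoc matrix_mul_assoc w_def)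
qed

lemma inner_sdiag: "v \<bullet> (sdiag U d *v v) = (\<Sum>i\<in>UNIV. d i * (norm ((madj U *v v) $ i))\<^sup>2)"
proof -
  define w where "w = madj U *v v"
  have "v \<bullet> (sdiag U d *v v) = v \<bullet> (U *v (diagm (\<lambda>i. complex_of_real (d i)) *v w))"
    by (simp add: w_def matrix_vector_mul_assoc matrix_mul_assoc)
  also have "\<dots> = w \<bullet> (diagm (\<lambda>i. complex_of_real (d i)) *v w)"
    by (simp add: w_def inner_madj)
  also have "\<dots> = (\<Sum>i\<in>UNIV. d i * (norm (w $ i))\<^sup>2)"
    by (simp add: inner_vec_def diagm_mult_vec_nth scaleR_conv_of_real[symmetric] dot_square_norm)
  finally show ?thesis by (simp add: w_def)
qed

lemma sdiag_eigenvector: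
  fixes U :: "'n::finite cmat"
  assumes U: "unitary U"
  shows "sdiag U d *v (U *v axis i 1) = d i *\<^sub>R (U *v axis i 1)" "norm (U *v axis i 1) = 1"
proof -
  have "diagm (\<lambda>i. complex_of_real (d i)) *v axis i 1 = d i *\<^sub>R axis i 1"
    by (simp add: vec_eq_iff diagm_mult_vec_nth axis_def scaleR_conv_of_real[where 'a=complex])
  then have "U *v (diagm (\<lambda>i. complex_of_real (d i)) *v axis i 1) = d i *\<^sub>R (U *v axis i 1)"
    by (simp add: mv.scaleR_right)
  then show "sdiag U d *v (U *v axis i 1) = d i *\<^sub>R (U *v axis i 1)"
    using U by (simp add: matrix_vector_mul_assoc matrix_mul_assoc[symmetric] unitary_left)
  have "(U *v axis i 1) \<bullet> (U *v axis i 1) = axis i 1 \<bullet> (axis i 1 :: complex^'n)"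
    using U by (simp add: inner_madj matrix_vector_mul_assoc unitary_left)
  then show "norm (U *v axis i 1) = 1"
    by (simp add: norm_eq_sqrt_inner inner_axis_axis)
qed

section \<open>Positive semidefinite matrices\<close>

lemma psd_sdiag: 
  assumes U: "unitary U"
  shows "psd (sdiag U d) \<longleftrightarrow> (\<forall>i. 0 \<le> d i)"
proof
  assume "psd (sdiag U d)"
  then have "0 \<le> (U *v axis i 1) \<bullet> (sdiag U d *v (U *v axis i 1))" for i
    unfolding psd_iff by blast
  then show "\<forall>i. 0 \<le> d i"
    by (simp only: sdiag_eigenvector[OF U] inner_scaleR_right dot_square_norm) simp
next
  assume "\<forall>i. 0 \<le> d i"
  then show "psd (sdiag U d)"
    unfolding psd_iff inner_sdiag by (auto intro!: sum_nonneg)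
qed

lemma psd_hermitian: "psd A \<Longrightarrow> hermitian A"
  by (simp add: psd_iff)

lemma psd_diagonalization:
  assumes "psd A"
  obtains U d where "unitary U" "A = sdiag U d" "\<And>i. 0 \<le> d i"
  using hermitian_diagonalization[OF psd_hermitian[OF assms]] assms psd_sdiag by metis

lemma matfun_cong:
  assumes "psd A" and "\<And>x. 0 \<le> x \<Longrightarrow> f x = g x"
  shows "matfun f A = matfun g A"
  by (rule psd_diagonalization[OF assms(1)]) (simp add: matfun_sdiag assms(2))

lemma psd_matfun:
  assumes "psd A" and "\<And>x. 0 \<le> x \<Longrightarrow> 0 \<le> f x"
  shows "psd (matfun f A)"
  by (rule psd_diagonalization[OF assms(1)]) (simp add: matfun_sdiag psd_sdiag assms(2))

lemma psd_diagonalization_le_1: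
  assumes "psd A" "psd (mat 1 - A)"
  obtains U d where "unitary U" "A = sdiag U d" "\<And>i. 0 \<le> d i" "\<And>i. d i \<le> 1"
proof -
  obtain U d where U: "unitary U" "A = sdiag U d" "\<And>i. 0 \<le> d i"
    using psd_diagonalization[OF assms(1)] by blast
  have E: "mat 1 - A = sdiag U (\<lambda>i. 1 - d i)"
    unfolding U(2) sdiag_1[OF U(1), symmetric] by (rule sdiag_diff)
  have "d i \<le> 1" for i using assms(2)[unfolded E psd_sdiag[OF U(1)]] by simp
  with U that show ?thesis by blast
qed

lemma psd_matfun_le_1:
  assumes "psd A" "psd (mat 1 - A)" and "\<And>x. 0 \<le> x \<Longrightarrow> x \<le> 1 \<Longrightarrow> 0 \<le> f x"
  shows "psd (matfun f A)"
  by (rule psd_diagonalization_le_1[OF assms(1,2)]) (simp add: matfun_sdiag psd_sdiag assms(3))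

lemma psd_add: "psd A \<Longrightarrow> psd B \<Longrightarrow> psd (A + B)"
  by (simp add: psd_iff hermitian_def mv.add_left inner_add_right)

lemma psd_scaleR: "0 \<le> c \<Longrightarrow> psd A \<Longrightarrow> psd (c *\<^sub>R A)"
  by (simp add: psd_iff hermitian_def mv.scaleR_left)

lemma psd_conj: "psd A \<Longrightarrow> psd (M ** A ** madj M)"
  unfolding psd_iff 
  by (simp add: hermitian_def matrix_mul_assoc[symmetric] matrix_vector_mul_assoc[symmetric])
    (metis inner_madj madj_madj)

lemma psd_conj_hermitian: "psd A \<Longrightarrow> hermitian M \<Longrightarrow> psd (M ** A ** M)"
  using psd_conj[of A M] by (simp add: hermitian_def)

lemma psd_mat_1 [simp]: "psd (mat 1)"
  by (simp add: psd_iff hermitian_def)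

text \<open>For the Hermitian root \<open>R\<close> of \<open>A\<close> the form at \<open>v\<close>
  is the squared norm of \<open>R *v v\<close>.\<close>

lemma psd_kernel:
  assumes A: "psd A" and v: "v \<bullet> (A *v v) = 0"
  shows "A *v v = 0"
proof -
  define R where "R = matfun sqrt A"
  have R: "hermitian R" by (simp add: R_def A psd_hermitian)
  have RR: "R ** R = A"
    unfolding R_def using A matfun_cong[OF A, of "\<lambda>x. sqrt x * sqrt x" "\<lambda>x. x"]
    by (simp add: matfun_mult psd_hermitian matfun_ident)
  have "(R *v v) \<bullet> (R *v v) = 0"
    using v by (simp add: hermitian_inner[OF R] matrix_vector_mul_assoc RR)
  then have "R *v v = 0" by simp
  then show ?thesis by (metis RR matrix_vector_mul_assoc matrix_vector_mult_0_right)
qed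

section \<open>Limits of matrices, eigenvalues and eigenbases\<close>

lemma tendsto_madj [tendsto_intros]:
  "(F \<longlongrightarrow> L) G \<Longrightarrow> ((\<lambda>x. madj (F x)) \<longlongrightarrow> madj L) G"
  unfolding madj_def by (intro tendsto_intros)

lemma psd_closed:
  assumes "(F \<longlongrightarrow> L) G" "\<forall>\<^sub>F x in G. psd (F x)" "G \<noteq> bot"
  shows "psd L"
proof -
  have "((\<lambda>x. madj (F x) - F x) \<longlongrightarrow> madj L - L) G"
    using assms(1) by (intro tendsto_intros)
  moreover have "((\<lambda>x. madj (F x) - F x) \<longlongrightarrow> 0) G"
    by (rule tendsto_eventually) (use assms(2) in \<open>auto simp: psd_iff hermitian_def elim: eventually_mono\<close>)
  ultimately have "madj L - L = 0" using assms(3) tendsto_unique by blast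
  moreover have "0 \<le> v \<bullet> (L *v v)" for v
  proof (rule tendsto_lowerbound)
    show "((\<lambda>x. v \<bullet> (F x *v v)) \<longlongrightarrow> v \<bullet> (L *v v)) G"
      using assms(1) by (intro tendsto_intros mv.tendsto)
    show "\<forall>\<^sub>F x in G. 0 \<le> v \<bullet> (F x *v v)"
      using assms(2) by (auto simp: psd_iff elim: eventually_mono)
  qed (use assms in auto)
  ultimately show ?thesis by (simp add: psd_iff hermitian_def)
qed

lemma tendsto_sdiag [tendsto_intros]:
  assumes "(U \<longlongrightarrow> V) G" "\<And>i. ((\<lambda>x. d x i) \<longlongrightarrow> e i) G"
  shows "((\<lambda>x. sdiag (U x) (d x)) \<longlongrightarrow> sdiag V e) G"
proof -
  have "((\<lambda>x. diagm (\<lambda>i. complex_of_real (d x i))) \<longlongrightarrow> diagm (\<lambda>i. complex_of_real (e i))) G"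
    unfolding diagm_def using assms(2) by (intro tendsto_intros) (auto intro!: tendsto_intros)
  then show ?thesis using assms(1) by (intro mm.tendsto tendsto_madj)
qed

lemma matfun_tendsto_pointwise:
  assumes "psd A" and "\<And>x. 0 \<le> x \<Longrightarrow> ((\<lambda>p. f p x) \<longlongrightarrow> g x) G"
  shows "((\<lambda>p. matfun (f p) A) \<longlongrightarrow> matfun g A) G"
  by (rule psd_diagonalization[OF assms(1)])
    (auto simp: matfun_sdiag intro!: tendsto_sdiag tendsto_const assms(2))

lemma closed_unitary: "closed (Collect (unitary :: 'n::finite cmat \<Rightarrow> bool))"
proof -
  have "continuous_on UNIV (\<lambda>U :: 'n cmat. madj U ** U)"
    unfolding continuous_on_def by (auto intro!: mm.tendsto tendsto_madj)
  then show ?thesis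
    unfolding unitary_def by (intro closed_Collect_eq continuous_on_const) auto
qed

lemma unitary_norm_nth_le:
  assumes "unitary U"
  shows "norm (U $ i $ j) \<le> 1"
proof -
  have "norm (U $ i $ j) = norm ((U *v axis j 1) $ i)"
    by (simp add: matrix_vector_mult_def axis_def if_distrib cong: if_cong)
  also have "\<dots> \<le> norm (U *v axis j 1)" by (rule Finite_Cartesian_Product.norm_nth_le)
  also have "\<dots> = 1" by (rule sdiag_eigenvector[OF assms])
  finally show ?thesis .
qed

lemma compact_unitary: "compact (Collect (unitary :: 'n::finite cmat \<Rightarrow> bool))"
proof -
  have "norm U \<le> of_nat CARD('n) * of_nat CARD('n)" if "unitary U" for U :: "'n cmat"
  proof -
    have "norm U \<le> (\<Sum>i\<in>UNIV. norm (U $ i))" by (simp add: norm_vec_def L2_set_le_sum)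
    also have "\<dots> \<le> (\<Sum>i\<in>(UNIV::'n set). of_nat CARD('n))"
    proof (rule sum_mono)
      fix i
      have "norm (U $ i) \<le> (\<Sum>j\<in>UNIV. norm (U $ i $ j))" by (simp add: norm_vec_def L2_set_le_sum)
      also have "\<dots> \<le> (\<Sum>j\<in>(UNIV::'n set). 1)" by (intro sum_mono unitary_norm_nth_le that)
      finally show "norm (U $ i) \<le> of_nat CARD('n)" by simp
    qed
    finally show ?thesis by simp
  qed
  then have "bounded (Collect (unitary :: 'n cmat \<Rightarrow> bool))" by (auto intro!: boundedI)
  then show ?thesis using closed_unitary compact_eq_bounded_closed by blast
qed

text \<open>Eigenbases of a convergent sequence need not converge, but unitary matrices form a
  compact set, so some subsequence of them does. Along it the eigenvalues converge as well, being
  the diagonal entries of \<open>madj U ** X ** U\<close>.\<close>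

lemma hermitian_seq_diagonalization:
  fixes X :: "nat \<Rightarrow> 'n::finite cmat"
  assumes X: "\<And>k. hermitian (X k)" and lim: "X \<longlonglongrightarrow> S"
  obtains r U d V e where "strict_mono r" "\<And>k. unitary (U k)" "\<And>k. X (r k) = sdiag (U k) (d k)"
    "unitary V" "S = sdiag V e" "U \<longlonglongrightarrow> V" "\<And>i. (\<lambda>k. d k i) \<longlonglongrightarrow> e i"
proof -
  have "\<forall>k. \<exists>U d. unitary U \<and> X k = sdiag U d"
    using hermitian_diagonalization[OF X] by metis
  then obtain U d where U: "\<And>k. unitary (U k)" "\<And>k. X k = sdiag (U k) (d k)" by metis
  obtain V r where V: "unitary V" and r: "strict_mono r" "(U \<circ> r) \<longlonglongrightarrow> V"
    using compact_imp_seq_compact[OF compact_unitary] U(1) unfolding seq_compact_def by blast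
  define M where "M = madj V ** S ** V"
  have Ur: "(\<lambda>k. U (r k)) \<longlonglongrightarrow> V" using r(2) by (simp add: o_def)
  have "(\<lambda>k. X (r k)) \<longlonglongrightarrow> S"
    using LIMSEQ_subseq_LIMSEQ[OF lim r(1)] by (simp add: o_def)
  then have "(\<lambda>k. madj (U (r k)) ** X (r k) ** U (r k)) \<longlonglongrightarrow> M"
    unfolding M_def by (intro mm.tendsto tendsto_madj Ur)
  moreover have "madj (U k) ** X k ** U k = diagm (\<lambda>i. complex_of_real (d k i))" for k
    using U by (simp add: matrix_mul_assoc[symmetric] unitary_cancel unitary_left)
  ultimately have D: "(\<lambda>k. diagm (\<lambda>i. complex_of_real (d (r k) i))) \<longlonglongrightarrow> M" by simp
  have Dij: "(\<lambda>k. diagm (\<lambda>i. complex_of_real (d (r k) i)) $ i $ j) \<longlonglongrightarrow> M $ i $ j" for i j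
    by (intro tendsto_vec_nth D)
  define e where "e i = Re (M $ i $ i)" for i
  have de: "(\<lambda>k. d (r k) i) \<longlonglongrightarrow> e i" for i
    using tendsto_Re[OF Dij[of i i]] by (simp add: diagm_def e_def)
  have "(\<lambda>k. sdiag (U (r k)) (d (r k))) \<longlonglongrightarrow> sdiag V e"
    by (intro tendsto_sdiag Ur de)
  then have "S = sdiag V e"
    using \<open>(\<lambda>k. X (r k)) \<longlonglongrightarrow> S\<close> by (metis (no_types, lifting) LIMSEQ_unique U(2) ext)
  with that[of r "\<lambda>k. U (r k)" "\<lambda>k. d (r k)" V e] show ?thesis
    using r(1) U V Ur de by blast
qed

text \<open>The subsequence principle: as the limit \<open>L\<close> is the same for all sequences,
  passing to subsequences costs nothing.\<close>

lemma tendsto_at_right_0_subseqI: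
  fixes F :: "real \<Rightarrow> 'a::metric_space"
  assumes "\<And>p. (\<And>k. (p k :: real) > 0) \<Longrightarrow> p \<longlonglongrightarrow> 0 \<Longrightarrow> \<exists>r::nat\<Rightarrow>nat. strict_mono r \<and> (\<lambda>k. F (p (r k))) \<longlonglongrightarrow> L"
  shows "(F \<longlongrightarrow> L) (at_right 0)"
  unfolding tendsto_at_iff_sequentially
proof (intro allI impI)
  fix p :: "nat \<Rightarrow> real" assume p: "\<forall>i. p i \<in> {0<..} - {0}" "p \<longlonglongrightarrow> 0"
  show "(F \<circ> p) \<longlonglongrightarrow> L"
  proof (rule ccontr)
    assume "\<not> (F \<circ> p) \<longlonglongrightarrow> L"
    then obtain e where e: "e > 0" "\<not> (\<forall>\<^sub>F k in sequentially. dist (F (p k)) L < e)"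
      unfolding tendsto_iff by auto
    define N where "N = {k. \<not> dist (F (p k)) L < e}"
    have "infinite N"
      using e(2) unfolding N_def by (metis cofinite_eq_sequentially eventually_cofinite)
    then have s: "strict_mono (enumerate N)" "\<And>k. enumerate N k \<in> N"
      by (auto simp: strict_mono_enumerate enumerate_in_set)
    obtain r :: "nat \<Rightarrow> nat" where r: "strict_mono r" "(\<lambda>k. F (p (enumerate N (r k)))) \<longlonglongrightarrow> L"
      using assms[of "p \<circ> enumerate N"] p LIMSEQ_subseq_LIMSEQ[OF p(2) s(1)] by (auto simp: o_def)
    from r(2) e(1) have "\<forall>\<^sub>F k in sequentially. dist (F (p (enumerate N (r k)))) L < e"
      unfolding tendsto_iff by blast
    moreover have "\<not> dist (F (p (enumerate N (r k)))) L < e" for k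
      using s(2)[of "r k"] by (simp add: N_def)
    ultimately show False by simp
  qed
qed

text \<open>Continuity of the functional calculus, for functions controlled only on
  \<open>{0..1}\<close>. That interval suffices for \<open>share\<close>, whose spectrum lies
  there.\<close>

lemma matfun_tendsto_le_1:
  fixes X :: "real \<Rightarrow> 'n::finite cmat"
  assumes f: "continuous_on {0..1} f"
    and X: "\<And>p. p > 0 \<Longrightarrow> psd (X p)" "\<And>p. p > 0 \<Longrightarrow> psd (mat 1 - X p)"
    and lim: "(X \<longlongrightarrow> S) (at_right 0)"
  shows "((\<lambda>p. matfun f (X p)) \<longlongrightarrow> matfun f S) (at_right 0)"
proof (rule tendsto_at_right_0_subseqI)
  fix p :: "nat \<Rightarrow> real" assume p: "\<And>k. p k > 0" "p \<longlonglongrightarrow> 0"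
  have Xp: "(\<lambda>k. X (p k)) \<longlonglongrightarrow> S"
    using lim p unfolding tendsto_at_iff_sequentially by (auto simp: o_def)
  obtain r U d V e where r: "strict_mono r" "\<And>k. unitary (U k)" "\<And>k. X (p (r k)) = sdiag (U k) (d k)"
    "unitary V" "S = sdiag V e" "U \<longlonglongrightarrow> V" "\<And>i. (\<lambda>k. d k i) \<longlonglongrightarrow> e i"
    using hermitian_seq_diagonalization[of "\<lambda>k. X (p k)", OF psd_hermitian[OF X(1)[OF p(1)]] Xp] by metis
  have d01: "d k i \<in> {0..1}" for k i
  proof -
    have E: "mat 1 - X (p (r k)) = sdiag (U k) (\<lambda>i. 1 - d k i)"
      unfolding r(3) sdiag_1[OF r(2), of k, symmetric] by (rule sdiag_diff)
    have "0 \<le> 1 - d k i" using X(2)[OF p(1), of "r k", unfolded E psd_sdiag[OF r(2)]] by blast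
    moreover have "0 \<le> d k i" using X(1)[OF p(1), of "r k", unfolded r(3) psd_sdiag[OF r(2)]] by blast
    ultimately show ?thesis by simp
  qed
  have e01: "e i \<in> {0..1}" for i
    by (rule closed_sequentially[OF _ _ r(7)]) (use d01 in auto)
  have "(\<lambda>k. f (d k i)) \<longlonglongrightarrow> f (e i)" for i
    by (rule continuous_on_tendsto_compose[OF f r(7) e01]) (use d01 in auto)
  then have "(\<lambda>k. sdiag (U k) (\<lambda>i. f (d k i))) \<longlonglongrightarrow> sdiag V (\<lambda>i. f (e i))"
    by (intro tendsto_sdiag r(6))
  then have "(\<lambda>k. matfun f (X (p (r k)))) \<longlonglongrightarrow> matfun f S"
    by (simp only: r matfun_sdiag)
  with r(1) show "\<exists>r. strict_mono r \<and> (\<lambda>k. matfun f (X (p (r k)))) \<longlonglongrightarrow> matfun f S" by blast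
qed

subsection \<open>Powers \<open>1 / p\<close> of matrices near a contraction\<close>

lemma powr_inverse_tendsto_0:
  fixes x q :: "nat \<Rightarrow> real"
  assumes q: "\<And>k. q k > 0" "q \<longlonglongrightarrow> 0" and x: "\<And>k. x k \<ge> 0" "x \<longlonglongrightarrow> e" and e: "e < 1"
  shows "(\<lambda>k. x k powr (1 / q k)) \<longlonglongrightarrow> 0"
proof -
  \<comment> \<open>\<open>b\<close> must be positive for \<open>ln b\<close> to be meaningful,
    hence \<open>max e 0\<close> in place of \<open>e\<close>.\<close>
  obtain b where b: "max e 0 < b" "b < 1" using e dense[of "max e 0" 1] by auto
  have "filterlim (\<lambda>k. inverse (q k)) at_top sequentially"
    by (rule filterlim_inverse_at_top) (use q in auto)
  then have "filterlim (\<lambda>k. ln b * inverse (q k)) at_bot sequentially"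
    using b by (intro filterlim_tendsto_neg_mult_at_bot[OF tendsto_const]) auto
  then have "(\<lambda>k. exp (ln b * inverse (q k))) \<longlonglongrightarrow> 0"
    by (rule filterlim_compose[OF exp_at_bot])
  then have lim: "(\<lambda>k. b powr (1 / q k)) \<longlonglongrightarrow> 0"
    using b by (simp add: powr_def divide_inverse mult.commute)
  have "\<forall>\<^sub>F k in sequentially. x k < b" using x(2) b order_tendstoD(2)[of x e] by auto
  then have "\<forall>\<^sub>F k in sequentially. x k powr (1 / q k) \<le> b powr (1 / q k)"
    by (rule eventually_mono) (use x q in \<open>auto intro!: powr_mono2 simp: less_imp_le\<close>)
  then show ?thesis
    by (intro tendsto_sandwich[OF _ _ tendsto_const lim]) auto
qed

text \<open>The bounds \<open>1 - 1 / x \<le> ln x \<le> x - 1\<close>, divided by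
  \<open>q k\<close>, squeeze the logarithm of the power.\<close>

lemma powr_inverse_tendsto_exp:
  fixes x q :: "nat \<Rightarrow> real"
  assumes q: "\<And>k. q k > 0" "q \<longlonglongrightarrow> 0" and m: "(\<lambda>k. (x k - 1) / q k) \<longlonglongrightarrow> m"
  shows "(\<lambda>k. x k powr (1 / q k)) \<longlonglongrightarrow> exp m"
proof -
  have "(\<lambda>k. 1 + (x k - 1) / q k * q k) \<longlonglongrightarrow> 1 + m * 0"
    using m q(2) by (intro tendsto_intros)
  moreover have "1 + (x k - 1) / q k * q k = x k" for k using q(1)[of k] by simp
  ultimately have x: "x \<longlonglongrightarrow> 1" by simp
  then have pos: "\<forall>\<^sub>F k in sequentially. x k > 0" using order_tendstoD(1)[of x 1] by auto
  have lo: "(\<lambda>k. (x k - 1) / q k / x k) \<longlonglongrightarrow> m / 1"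
    using m x by (intro tendsto_intros) auto
  have "(\<lambda>k. ln (x k) / q k) \<longlonglongrightarrow> m"
  proof (rule tendsto_sandwich)
    show "(\<lambda>k. (x k - 1) / q k / x k) \<longlonglongrightarrow> m" using lo by simp
    show "\<forall>\<^sub>F k in sequentially. ln (x k) / q k \<le> (x k - 1) / q k"
      using pos by (rule eventually_mono) (intro divide_right_mono ln_le_minus_one less_imp_le[OF q(1)])
    show "\<forall>\<^sub>F k in sequentially. (x k - 1) / q k / x k \<le> ln (x k) / q k"
      using pos
    proof (rule eventually_mono)
      fix k assume k: "x k > 0"
      then have "ln (1 / x k) \<le> 1 / x k - 1" by (intro ln_le_minus_one) auto
      then have "(x k - 1) / x k \<le> ln (x k)" using k by (simp add: ln_div field_simps)
      then have "(x k - 1) / x k / q k \<le> ln (x k) / q k"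
        using q(1)[of k] by (intro divide_right_mono) auto
      then show "(x k - 1) / q k / x k \<le> ln (x k) / q k" by (simp add: mult.commute)
    qed
  qed (rule m)
  then have "(\<lambda>k. exp (ln (x k) / q k)) \<longlonglongrightarrow> exp m" by (rule tendsto_exp)
  then show ?thesis
    by (rule Lim_transform_eventually)
      (use pos in \<open>auto elim!: eventually_mono simp: powr_def\<close>)
qed

text \<open>
  Only the eigenvalues tending to 1 survive the power \<open>1 / p\<close>, and by the eigenvalue equation
  compressed to the limiting eigenspace their slopes are the eigenvalues of \<open>W ** P\<close>. Hence
  first-order information is needed on the rows of \<open>X p\<close> in the range of \<open>P\<close> only, and
  convergence of eigenbases along subsequences suffices.
\<close>

lemma mpow_inverse_tendsto:
  fixes X :: "real \<Rightarrow> 'n::finite cmat"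
  assumes X: "\<And>p. p > 0 \<Longrightarrow> psd (X p)"
    and S: "(X \<longlongrightarrow> S) (at_right 0)" "psd (mat 1 - S)"
    and P: "P = matfun (\<lambda>x. if x = 1 then 1 else 0) S"
    and W: "((\<lambda>p. (1 / p) *\<^sub>R (P ** (X p - mat 1))) \<longlongrightarrow> W) (at_right 0)"
  shows "((\<lambda>p. mpow (X p) (1 / p)) \<longlongrightarrow> P ** mexp (W ** P)) (at_right 0)"
proof (rule tendsto_at_right_0_subseqI)
  fix p :: "nat \<Rightarrow> real" assume p: "\<And>k. p k > 0" "p \<longlonglongrightarrow> 0"
  have Xp: "(\<lambda>k. X (p k)) \<longlonglongrightarrow> S"
    using S p unfolding tendsto_at_iff_sequentially by (auto simp: o_def)
  obtain r U d V e where r: "strict_mono r" "\<And>k. unitary (U k)" "\<And>k. X (p (r k)) = sdiag (U k) (d k)"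
    "unitary V" "S = sdiag V e" "U \<longlonglongrightarrow> V" "\<And>i. (\<lambda>k. d k i) \<longlonglongrightarrow> e i"
    using hermitian_seq_diagonalization[of "\<lambda>k. X (p k)", OF psd_hermitian[OF X[OF p(1)]] Xp] by metis
  define q where "q = (\<lambda>k. p (r k))"
  have q: "\<And>k. q k > 0" "q \<longlonglongrightarrow> 0"
    using p LIMSEQ_subseq_LIMSEQ[OF p(2) r(1)] by (auto simp: q_def o_def)
  have Xq: "X (q k) = sdiag (U k) (d k)" for k by (simp add: q_def r(3))
  have d0: "0 \<le> d k i" for k i using X[OF q(1), of k, unfolded Xq psd_sdiag[OF r(2)]] by blast
  have E: "mat 1 - S = sdiag V (\<lambda>i. 1 - e i)"
    unfolding r(5) sdiag_1[OF r(4), symmetric] by (rule sdiag_diff)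
  have e1: "e i \<le> 1" for i using S(2)[unfolded E psd_sdiag[OF r(4)]] by simp
  define c where "c = (\<lambda>i. if e i = 1 then 1 else 0::real)"
  have Pc: "P = sdiag V c" by (simp only: P r(5) matfun_sdiag[OF r(4)] c_def)
  \<comment> \<open>\<open>Y k\<close> and \<open>M\<close> express \<open>P\<close> and
    \<open>W\<close> in the moving and in the limiting eigenbasis. There
    \<open>X (q k) - mat 1\<close> is diagonal, so the hypothesis on \<open>W\<close> becomes a
    statement on the entries of \<open>Y k\<close> times the slopes
    \<open>(d k j - 1) / q k\<close>.\<close>
  define Y where "Y k = madj (U k) ** P ** U k" for k
  define M where "M = madj V ** W ** V"
  have VPV: "madj V ** P ** V = diagm (\<lambda>i. complex_of_real (c i))"
    using r(4) by (simp add: Pc matrix_mul_assoc[symmetric] unitary_cancel unitary_left)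
  have "Y \<longlonglongrightarrow> madj V ** P ** V"
    unfolding Y_def by (intro mm.tendsto tendsto_madj r(6) tendsto_const)
  then have Yij: "(\<lambda>k. Y k $ i $ j) \<longlonglongrightarrow> (if i = j then complex_of_real (c i) else 0)" for i j
    unfolding VPV by (drule_tac tendsto_vec_nth[of _ _ _ i], drule_tac tendsto_vec_nth[of _ _ _ j]) (simp add: diagm_def)
  have "(\<lambda>k. (1 / q k) *\<^sub>R (P ** (X (q k) - mat 1))) \<longlonglongrightarrow> W"
    using W q unfolding tendsto_at_iff_sequentially by (auto simp: o_def)
  then have "(\<lambda>k. madj (U k) ** ((1 / q k) *\<^sub>R (P ** (X (q k) - mat 1))) ** U k) \<longlonglongrightarrow> M"
    unfolding M_def by (intro mm.tendsto tendsto_madj r(6))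
  moreover have "madj (U k) ** ((1 / q k) *\<^sub>R (P ** (X (q k) - mat 1))) ** U k
     = Y k ** diagm (\<lambda>i. complex_of_real ((d k i - 1) / q k))" for k
  proof -
    have "(1 / q k) *\<^sub>R (X (q k) - mat 1) = sdiag (U k) (\<lambda>i. (1 / q k) * (d k i - 1))"
      unfolding Xq sdiag_1[OF r(2), of k, symmetric] sdiag_diff sdiag_scaleR ..
    then have "madj (U k) ** ((1 / q k) *\<^sub>R (P ** (X (q k) - mat 1))) ** U k
      = madj (U k) ** (P ** sdiag (U k) (\<lambda>i. (1 / q k) * (d k i - 1))) ** U k"
      by (simp only: mm.scaleR_right[symmetric])
    also have "\<dots> = Y k ** diagm (\<lambda>i. complex_of_real ((1 / q k) * (d k i - 1)))"
      using r(2)[of k] by (simp add: Y_def matrix_mul_assoc[symmetric] unitary_left)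
    finally show ?thesis by simp
  qed
  ultimately have "(\<lambda>k. Y k ** diagm (\<lambda>i. complex_of_real ((d k i - 1) / q k))) \<longlonglongrightarrow> M" by simp
  then have Mij: "(\<lambda>k. Y k $ i $ j * complex_of_real ((d k j - 1) / q k)) \<longlonglongrightarrow> M $ i $ j" for i j
    by (drule_tac tendsto_vec_nth[of _ _ _ i], drule_tac tendsto_vec_nth[of _ _ _ j]) (simp only: mult_diagm_nth)
  \<comment> \<open>For \<open>e j = 1\<close> the entry \<open>Y k $ j $ j\<close> tends to 1, so
    dividing by it isolates the slope. For \<open>e j < 1\<close> it tends to 0 and the slope
    diverges; such columns are removed later by the factor \<open>P\<close> on the right.\<close>
  have conv: "(\<lambda>k. complex_of_real ((d k j - 1) / q k)) \<longlonglongrightarrow> M $ j $ j" if "e j = 1" for j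
  proof -
    have Yjj: "(\<lambda>k. Y k $ j $ j) \<longlonglongrightarrow> 1" using Yij[of j j] that by (simp add: c_def)
    then have ev: "\<forall>\<^sub>F k in sequentially. Y k $ j $ j \<noteq> 0" by (rule tendsto_imp_eventually_ne) simp
    have "(\<lambda>k. Y k $ j $ j * complex_of_real ((d k j - 1) / q k) / Y k $ j $ j) \<longlonglongrightarrow> M $ j $ j / 1"
      by (intro tendsto_divide Mij Yjj) simp
    then have "(\<lambda>k. Y k $ j $ j * complex_of_real ((d k j - 1) / q k) / Y k $ j $ j) \<longlonglongrightarrow> M $ j $ j" by simp
    then show ?thesis
      by (rule Lim_transform_eventually) (use ev in \<open>auto elim!: eventually_mono\<close>)
  qed
  define m where "m j = Re (M $ j $ j)" for j
  have dm: "(\<lambda>k. (d k j - 1) / q k) \<longlonglongrightarrow> m j" if "e j = 1" for j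
    using tendsto_Re[OF conv[OF that]] by (simp add: m_def)
  \<comment> \<open>Off the diagonal \<open>Y k $ i $ j\<close> tends to 0 while the slope stays
    bounded, so these entries of \<open>M\<close> vanish. This makes \<open>W ** P\<close> diagonal
    in the basis \<open>V\<close>.\<close>
  have Mm: "M $ i $ j = (if i = j then complex_of_real (m j) else 0)" if "e j = 1" for i j
  proof (cases "i = j")
    case True
    then show ?thesis using LIMSEQ_unique[OF tendsto_of_real[OF dm[OF that]] conv[OF that]] by simp
  next
    case False
    have "(\<lambda>k. Y k $ i $ j * complex_of_real ((d k j - 1) / q k)) \<longlonglongrightarrow> 0 * M $ j $ j"
      by (intro tendsto_mult conv that) (use Yij[of i j] False in simp)
    then show ?thesis using LIMSEQ_unique[OF Mij] False by auto
  qed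
  \<comment> \<open>The default 0 is harmless: its exponential 1 is multiplied by
    \<open>c i = 0\<close>.\<close>
  define g where "g j = (if e j = 1 then m j else 0)" for j
  have "M ** diagm (\<lambda>i. complex_of_real (c i)) = diagm (\<lambda>i. complex_of_real (g i))"
    unfolding vec_eq_iff mult_diagm_nth by (auto simp: c_def g_def diagm_def Mm)
  then have "V ** (M ** diagm (\<lambda>i. complex_of_real (c i))) ** madj V = sdiag V g" by simp
  moreover have "V ** (M ** diagm (\<lambda>i. complex_of_real (c i))) ** madj V = W ** P"
    using r(4) by (simp add: M_def Pc matrix_mul_assoc[symmetric] unitary_cancel)
  ultimately have WP: "W ** P = sdiag V g" by simp
  have rhs: "P ** mexp (W ** P) = sdiag V (\<lambda>i. c i * exp (g i))"
  proof -
    have "P ** mexp (W ** P) = P ** sdiag V (\<lambda>i. exp (g i))"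
      by (simp only: WP mexp_def matfun_sdiag[OF r(4)])
    then show ?thesis by (simp only: Pc sdiag_mult[OF r(4)])
  qed
  have "(\<lambda>k. d k i powr (1 / q k)) \<longlonglongrightarrow> c i * exp (g i)" for i
  proof (cases "e i = 1")
    case True
    then show ?thesis using powr_inverse_tendsto_exp[OF q dm] by (simp add: c_def g_def)
  next
    case False
    then have "e i < 1" using e1[of i] by simp
    then show ?thesis using powr_inverse_tendsto_0[OF q d0 r(7)] False by (simp add: c_def)
  qed
  then have "(\<lambda>k. sdiag (U k) (\<lambda>i. d k i powr (1 / q k))) \<longlonglongrightarrow> P ** mexp (W ** P)"
    unfolding rhs by (intro tendsto_sdiag r(6))
  moreover have "(\<lambda>k. mpow (X (q k)) (1 / q k)) = (\<lambda>k. sdiag (U k) (\<lambda>i. d k i powr (1 / q k)))"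
    unfolding mpow_def Xq matfun_sdiag[OF r(2)] ..
  ultimately have "(\<lambda>k. mpow (X (q k)) (1 / q k)) \<longlonglongrightarrow> P ** mexp (W ** P)" by (simp only:)
  then have "(\<lambda>k. mpow (X (p (r k))) (1 / p (r k))) \<longlonglongrightarrow> P ** mexp (W ** P)"
    unfolding q_def .
  with r(1) show "\<exists>r. strict_mono r \<and> (\<lambda>k. mpow (X (p (r k))) (1 / p (r k))) \<longlonglongrightarrow> P ** mexp (W ** P)"
    by blast
qed

text \<open>Diagonal entries are monotone in the semidefinite order, other entries are not. Bounding
  all entries by diagonal ones is what makes order bounds usable for convergence.\<close>

lemma psd_entry_bound:
  assumes Y: "psd Y"
  shows "norm (Y $ i $ j) \<le> Re (Y $ i $ i) + Re (Y $ j $ j)"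
proof -
  have ax: "(Y *v (axis a z)) $ b = Y $ b $ a * z" for a b z
    by (simp add: matrix_vector_mult_def axis_def if_distrib cong: if_cong)
  have ii: "0 \<le> Re (Y $ k $ k)" for k
  proof -
    have "0 \<le> axis k 1 \<bullet> (Y *v axis k 1)" using Y by (simp add: psd_iff)
    then show ?thesis by (simp add: inner_axis' ax inner_complex_def)
  qed
  have herm: "Y $ j $ i = cnj (Y $ i $ j)"
  proof -
    have "madj Y $ j $ i = Y $ j $ i" using psd_hermitian[OF Y] by (simp add: hermitian_def)
    then show ?thesis by (simp add: madj_def)
  qed
  show ?thesis
  proof (cases "Y $ i $ j = 0")
    case True
    then show ?thesis using ii[of i] ii[of j] by simp
  next
    case False
    \<comment> \<open>The phase of modulus 1 that turns the cross term of the form at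
      \<open>v\<close> into minus twice the modulus of \<open>Y $ i $ j\<close>.\<close>
    define z where "z = - cnj (Y $ i $ j) / norm (Y $ i $ j)"
    have yz: "Y $ i $ j * z = - of_real (norm (Y $ i $ j))"
      using False by (simp add: z_def complex_norm_square[symmetric] power2_eq_square)
    have zz: "cnj z * z = 1"
      using False by (simp add: z_def complex_norm_square[symmetric] power2_eq_square mult.commute)
    define v where "v = axis i 1 + axis j z"
    have "0 \<le> v \<bullet> (Y *v v)" using Y by (simp add: psd_iff)
    also have "v \<bullet> (Y *v v) = Re (Y $ i $ i + Y $ i $ j * z + cnj z * (Y $ j $ i) + cnj z * z * Y $ j $ j)"
      by (simp add: v_def mv.add_right inner_add_left inner_axis' ax inner_complex_def algebra_simps)
    also have "cnj z * (Y $ j $ i) = cnj (Y $ i $ j * z)" by (simp add: herm)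
    also have "Re (Y $ i $ i + Y $ i $ j * z + cnj (Y $ i $ j * z) + cnj z * z * Y $ j $ j)
      = Re (Y $ i $ i) + Re (Y $ j $ j) - 2 * norm (Y $ i $ j)"
      by (simp add: yz zz)
    finally show ?thesis using norm_ge_zero[of "Y $ i $ j"] by linarith
  qed
qed

text \<open>The diagonal of \<open>X p - F p\<close> lies below that of \<open>H p - F p\<close>,
  which tends to 0, and by \<open>psd_entry_bound\<close> the diagonal controls the remaining
  entries.\<close>

lemma psd_squeeze:
  fixes X :: "real \<Rightarrow> 'n::finite cmat"
  assumes "\<forall>\<^sub>F p in G. psd (X p - F p)" "\<forall>\<^sub>F p in G. psd (H p - X p)"
    and F: "(F \<longlongrightarrow> L) G" and H: "(H \<longlongrightarrow> L) G"
  shows "(X \<longlongrightarrow> L) G"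
proof -
  have FH: "((\<lambda>p. H p - F p) \<longlongrightarrow> 0) G" using tendsto_diff[OF H F] by simp
  have tr: "((\<lambda>p. Re ((H p - F p) $ i $ i) + Re ((H p - F p) $ j $ j)) \<longlongrightarrow> Re (0 $ i $ i) + Re (0 $ j $ j)) G" for i j
    by (intro tendsto_intros FH)
  have "((\<lambda>p. (X p - F p) $ i $ j) \<longlongrightarrow> 0) G" for i j
  proof (rule tendsto_0_le[where K = 1])
    show "((\<lambda>p. Re ((H p - F p) $ i $ i) + Re ((H p - F p) $ j $ j)) \<longlongrightarrow> 0) G" using tr[of i j] by simp
    show "\<forall>\<^sub>F p in G. norm ((X p - F p) $ i $ j) \<le> norm (Re ((H p - F p) $ i $ i) + Re ((H p - F p) $ j $ j)) * 1"
      using assms(1,2)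
    proof eventually_elim
      case (elim p)
      have "0 \<le> Re ((H p - X p) $ k $ k)" for k
        using psd_entry_bound[OF elim(2), of k k] norm_ge_zero[of "(H p - X p) $ k $ k"] by linarith
      from this[of i] this[of j] psd_entry_bound[OF elim(1), of i j] show ?case by simp
    qed
  qed
  then have "((\<lambda>p. X p - F p) \<longlongrightarrow> 0) G" by (intro vec_tendstoI) auto
  from tendsto_add[OF this F] show ?thesis by simp
qed

subsection \<open>Geometric and harmonic means of semidefinite matrices\<close>

definition pd :: "'n::finite cmat \<Rightarrow> bool" where
  "pd A \<longleftrightarrow> hermitian A \<and> (\<forall>v. v \<noteq> 0 \<longrightarrow> 0 < v \<bullet> (A *v v))"

lemma pd_hermitian: "pd A \<Longrightarrow> hermitian A"
  by (simp add: pd_def)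

lemma pd_imp_psd: "pd A \<Longrightarrow> psd A"
  unfolding pd_def psd_iff by (metis inner_zero_left less_imp_le order_refl)

lemma pd_add_scaled_id: "psd A \<Longrightarrow> 0 < e \<Longrightarrow> pd (A + e *\<^sub>R mat 1)"
  by (auto simp: pd_def psd_iff hermitian_def mv.add_left mv.scaleR_left inner_add_right add_nonneg_pos)

lemma pd_add: "pd A \<Longrightarrow> pd B \<Longrightarrow> pd (A + B)"
  by (auto simp: pd_def hermitian_def mv.add_left inner_add_right add_pos_pos)

lemma pd_scaleR: "0 < c \<Longrightarrow> pd A \<Longrightarrow> pd (c *\<^sub>R A)"
  by (simp add: pd_def hermitian_def mv.scaleR_left)

lemma pd_conj:
  fixes A :: "'n::finite cmat"
  assumes "pd A" "hermitian M" "M' ** M = mat 1"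
  shows "pd (M ** A ** M)"
  unfolding pd_def
proof (intro conjI allI impI)
  show "hermitian (M ** A ** M)"
    using assms by (simp add: hermitian_def pd_def matrix_mul_assoc)
  fix v :: "(complex, 'n) vec" assume "v \<noteq> 0"
  then have "M *v v \<noteq> 0"
    using assms(3) by (metis matrix_vector_mul_assoc matrix_vector_mul_lid matrix_vector_mult_0_right)
  then have "0 < (M *v v) \<bullet> (A *v (M *v v))" using assms(1) by (simp add: pd_def)
  then show "0 < v \<bullet> (M ** A ** M *v v)"
    by (simp add: hermitian_inner[OF assms(2)] matrix_vector_mul_assoc[symmetric])
qed

lemma pd_diagonalization:
  assumes "pd A"
  obtains U d where "unitary U" "A = sdiag U d" "\<And>i. 0 < d i"
proof -
  obtain U d where U: "unitary U" "A = sdiag U d"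
    using hermitian_diagonalization[OF pd_hermitian[OF assms]] by blast
  have "0 < d i" for i
  proof -
    have "U *v axis i 1 \<noteq> 0" using sdiag_eigenvector(2)[OF U(1), of i] by auto
    then have "0 < (U *v axis i 1) \<bullet> (sdiag U d *v (U *v axis i 1))"
      using assms unfolding pd_def U(2) by blast
    then show ?thesis
      by (simp only: sdiag_eigenvector[OF U(1)] inner_scaleR_right dot_square_norm) simp
  qed
  with U that show ?thesis by blast
qed

lemma matfun_cong_pd:
  assumes "pd A" and "\<And>x. 0 < x \<Longrightarrow> f x = g x"
  shows "matfun f A = matfun g A"
  by (rule pd_diagonalization[OF assms(1)]) (simp add: matfun_sdiag assms(2))

lemma psd_matfun_pd:
  assumes "pd A" and "\<And>x. 0 < x \<Longrightarrow> 0 \<le> f x"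
  shows "psd (matfun f A)"
  by (rule pd_diagonalization[OF assms(1)]) (simp add: matfun_sdiag psd_sdiag assms(2))

lemma matfun_cong_pd_between:
  assumes "pd T" "pd (mat 1 - T)" and "\<And>x. 0 < x \<Longrightarrow> x < 1 \<Longrightarrow> f x = g x"
  shows "matfun f T = matfun g T"
proof -
  obtain U d where U: "unitary U" "T = sdiag U d" "\<And>i. 0 < d i"
    using pd_diagonalization[OF assms(1)] by blast
  have E: "mat 1 - T = sdiag U (\<lambda>i. 1 - d i)"
    unfolding U(2) sdiag_1[OF U(1), symmetric] by (rule sdiag_diff)
  have "d i < 1" for i
  proof -
    have nz: "U *v axis i 1 \<noteq> 0" using sdiag_eigenvector(2)[OF U(1), of i] by auto
    have "0 < (U *v axis i 1) \<bullet> (sdiag U (\<lambda>i. 1 - d i) *v (U *v axis i 1))"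
      using assms(2) nz unfolding pd_def E by blast
    then show ?thesis
      by (simp only: sdiag_eigenvector[OF U(1)] inner_scaleR_right dot_square_norm) simp
  qed
  then show ?thesis using assms(3) U(3) unfolding U(2) matfun_sdiag[OF U(1)] by simp
qed

lemma ginv_pd: "pd N \<Longrightarrow> ginv N ** N = mat 1"
proof -
  assume N: "pd N"
  have "ginv N ** matfun (\<lambda>x. x) N = matfun (\<lambda>x. 1) N"
    unfolding ginv_def matfun_mult[OF pd_hermitian[OF N]] by (rule matfun_cong_pd[OF N]) simp
  then show ?thesis by (simp only: matfun_ident[OF pd_hermitian[OF N]] matfun_one[OF pd_hermitian[OF N]])
qed

lemma ginv_eqI: "pd N \<Longrightarrow> N ** Y = mat 1 \<Longrightarrow> ginv N = Y"
  by (metis ginv_pd matrix_mul_assoc matrix_mul_lid matrix_mul_rid)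

lemma pd_ginv:
  assumes "pd X"
  shows "pd (ginv X)"
proof -
  have psd: "psd (ginv X)"
    unfolding ginv_def by (rule psd_matfun_pd[OF assms]) simp
  have "v = 0" if "v \<bullet> (ginv X *v v) = 0" for v
  proof -
    have "ginv X *v v = 0" using psd_kernel psd that by blast
    moreover have "X ** ginv X = mat 1" using ginv_pd[OF assms] by (simp add: matrix_left_right_inverse)
    ultimately show ?thesis by (metis matrix_vector_mul_assoc matrix_vector_mul_lid matrix_vector_mult_0_right)
  qed
  with psd show ?thesis unfolding pd_def psd_iff by (metis order_le_less)
qed

text \<open>
  Following Pusz and Woronowicz, with \<open>Q = (A + B)\<^sup>1\<^sup>/\<^sup>2\<close> one has \<open>A = Q ** T ** Q\<close> and
  \<open>B = Q ** (mat 1 - T) ** Q\<close> for \<open>T = share A B\<close>, and both means take the form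
  \<open>Q ** matfun h T ** Q\<close> with \<open>h\<close> continuous on \<open>{0..1}\<close>. Unlike \<open>A\<^sup>-\<^sup>1\<^sup>/\<^sup>2\<close>, the matrices
  \<open>Q\<close> and \<open>T\<close> converge when \<open>A\<close> and \<open>B\<close> degenerate.
\<close>

definition sum_sqrt :: "'n::finite cmat \<Rightarrow> 'n cmat \<Rightarrow> 'n cmat" where
  "sum_sqrt A B = matfun sqrt (A + B)"

definition sum_rsqrt :: "'n::finite cmat \<Rightarrow> 'n cmat \<Rightarrow> 'n cmat" where
  "sum_rsqrt A B = matfun (\<lambda>x. 1 / sqrt x) (A + B)"

definition share :: "'n::finite cmat \<Rightarrow> 'n cmat \<Rightarrow> 'n cmat" where
  "share A B = sum_rsqrt A B ** A ** sum_rsqrt A B"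

lemma sum_sqrt_facts:
  assumes A: "pd A" and B: "pd B"
  shows "hermitian (sum_sqrt A B)" "hermitian (sum_rsqrt A B)"
    "sum_sqrt A B ** sum_rsqrt A B = mat 1" "sum_rsqrt A B ** sum_sqrt A B = mat 1"
    "sum_sqrt A B ** sum_sqrt A B = A + B"
proof -
  have C: "pd (A + B)" using A B by (rule pd_add)
  note h = pd_hermitian[OF C]
  show "hermitian (sum_sqrt A B)" "hermitian (sum_rsqrt A B)"
    using h by (simp_all add: sum_sqrt_def sum_rsqrt_def)
  have "sum_sqrt A B ** sum_rsqrt A B = matfun (\<lambda>x. 1) (A + B)"
    unfolding sum_sqrt_def sum_rsqrt_def matfun_mult[OF h] by (rule matfun_cong_pd[OF C]) simp
  then show 1: "sum_sqrt A B ** sum_rsqrt A B = mat 1" using h by (simp add: matfun_one)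
  then show "sum_rsqrt A B ** sum_sqrt A B = mat 1" by (simp add: matrix_left_right_inverse)
  have "sum_sqrt A B ** sum_sqrt A B = matfun (\<lambda>x. x) (A + B)"
    unfolding sum_sqrt_def matfun_mult[OF h] by (rule matfun_cong_pd[OF C]) simp
  then show "sum_sqrt A B ** sum_sqrt A B = A + B" using h by (simp add: matfun_ident)
qed

lemma share_facts:
  assumes A: "pd A" and B: "pd B"
  shows "pd (share A B)" "pd (mat 1 - share A B)"
    "sum_sqrt A B ** share A B ** sum_sqrt A B = A"
    "sum_sqrt A B ** (mat 1 - share A B) ** sum_sqrt A B = B"
proof -
  note f = sum_sqrt_facts[OF A B]
  show "pd (share A B)" unfolding share_def by (rule pd_conj[OF A f(2,3)])
  have "mat 1 = sum_rsqrt A B ** (A + B) ** sum_rsqrt A B"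
    by (metis f(3-5) matrix_mul_assoc matrix_mul_lid)
  then have "mat 1 - share A B = sum_rsqrt A B ** B ** sum_rsqrt A B"
    by (simp add: share_def mm.add_left mm.add_right)
  then show "pd (mat 1 - share A B)" using pd_conj[OF B f(2,3)] by simp
  show 1: "sum_sqrt A B ** share A B ** sum_sqrt A B = A"
    by (metis f(3,4) matrix_mul_assoc matrix_mul_lid matrix_mul_rid share_def)
  show "sum_sqrt A B ** (mat 1 - share A B) ** sum_sqrt A B = B"
    by (simp add: mm.diff_left mm.diff_right 1 f(5))
qed

text \<open>With \<open>H = mpow A (1/2)\<close> and \<open>Z = Hi ** B ** Hi\<close> one has
  \<open>A + B = H ** (mat 1 + Z) ** H\<close>, and \<open>share A B\<close> is unitarily equivalent
  to the inverse of \<open>mat 1 + Z\<close>. The claim then reduces to the scalar identity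
  \<open>(1 + z) * h (1 / (1 + z)) = z powr \<alpha>\<close>.\<close>

lemma gmean_pd_eq:
  assumes A: "pd A" and B: "pd B" and \<alpha>: "0 < \<alpha>" "\<alpha> < 1"
  shows "gmean_pd \<alpha> A B = sum_sqrt A B ** matfun (\<lambda>t. t powr (1 - \<alpha>) * (1 - t) powr \<alpha>) (share A B) ** sum_sqrt A B"
proof -
  note f = sum_sqrt_facts[OF A B]
  define H Hi where "H = mpow A (1/2)" and "Hi = mnpow A (1/2)"
  note hA = pd_hermitian[OF A]
  have Hi: "Hi = matfun (\<lambda>x. (if x = 0 then 0 else 1 / x) powr (1/2)) A"
    unfolding Hi_def mnpow_def mpow_def ginv_def by (rule matfun_compose[OF hA])
  have hH: "hermitian H" "hermitian Hi" by (simp_all add: H_def Hi mpow_def hA)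
  have "H ** H = matfun (\<lambda>x. x) A"
    unfolding H_def mpow_def matfun_mult[OF hA] 
    by (rule matfun_cong_pd[OF A]) (simp add: powr_add[symmetric])
  then have HH: "H ** H = A" by (simp add: matfun_ident hA)
  have "H ** Hi = matfun (\<lambda>x. 1) A"
    unfolding H_def mpow_def Hi matfun_mult[OF hA] 
    by (rule matfun_cong_pd[OF A]) (simp add: powr_divide)
  then have HHi: "H ** Hi = mat 1" by (simp add: matfun_one hA)
  then have HiH: "Hi ** H = mat 1" by (simp add: matrix_left_right_inverse)
  define Z where "Z = Hi ** B ** Hi"
  have Z: "psd Z" unfolding Z_def by (rule psd_conj_hermitian[OF pd_imp_psd[OF B] hH(2)])
  note hZ = psd_hermitian[OF Z]
  have HZH: "H ** Z ** H = B"
    by (metis HHi HiH Z_def matrix_mul_assoc matrix_mul_lid matrix_mul_rid)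
  define R where "R = matfun (\<lambda>z. sqrt (1 + z)) Z"
  have hR: "hermitian R" by (simp add: R_def hZ)
  have "R ** R = matfun (\<lambda>z. 1 + z) Z"
    unfolding R_def matfun_mult[OF hZ] by (rule matfun_cong[OF Z]) simp
  then have RR: "R ** R = mat 1 + Z"
    by (simp add: matfun_add[OF hZ, symmetric] matfun_one matfun_ident hZ)
  \<comment> \<open>\<open>sum_sqrt A B\<close> and \<open>H ** R\<close> both give
    \<open>A + B\<close> when multiplied by their adjoints on the right, so they differ by a unitary
    factor, and \<open>V\<close> is that factor.\<close>
  define V where "V = sum_rsqrt A B ** H ** R"
  have HRRH: "H ** (R ** R) ** H = A + B"
    by (simp add: RR mm.add_left mm.add_right HH HZH)
  have "V ** madj V = sum_rsqrt A B ** (H ** (R ** R) ** H) ** sum_rsqrt A B"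
    using f(2) hH hR by (simp add: V_def hermitian_def matrix_mul_assoc)
  also have "\<dots> = mat 1"
    unfolding HRRH f(5)[symmetric] by (metis f(3,4) matrix_mul_assoc matrix_mul_lid)
  finally have "unitary V" by (simp add: unitary_def matrix_left_right_inverse)
  define Y where "Y = matfun (\<lambda>z. 1 / (1 + z)) Z"
  have hY: "hermitian Y" by (simp add: Y_def hZ)
  have "R ** Y ** R = matfun (\<lambda>z. 1) Z"
    unfolding R_def Y_def matfun_mult[OF hZ]
    by (rule matfun_cong[OF Z]) (simp add: field_simps)
  then have RYR: "R ** Y ** R = mat 1" by (simp add: matfun_one hZ)
  have "V ** Y ** madj V = sum_rsqrt A B ** (H ** (R ** Y ** R) ** H) ** sum_rsqrt A B"
    using f(2) hH hR by (simp add: V_def hermitian_def matrix_mul_assoc)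
  then have T: "share A B = V ** Y ** madj V" by (simp add: RYR HH share_def)
  let ?h = "\<lambda>t::real. t powr (1 - \<alpha>) * (1 - t) powr \<alpha>"
  have QV: "sum_sqrt A B ** V = H ** R"
    by (simp add: V_def matrix_mul_assoc f(3))
  then have VQ: "madj V ** sum_sqrt A B = R ** H"
    using hH hR f(1) by (metis hermitian_def madj_mult)
  have "sum_sqrt A B ** matfun ?h (share A B) ** sum_sqrt A B
    = (sum_sqrt A B ** V) ** matfun ?h Y ** (madj V ** sum_sqrt A B)"
    unfolding T matfun_unitary_conj[OF \<open>unitary V\<close> hY] by (simp add: matrix_mul_assoc)
  also have "\<dots> = H ** (R ** matfun ?h Y ** R) ** H"
    unfolding QV VQ by (simp add: matrix_mul_assoc)
  also have "R ** matfun ?h Y ** R = matfun (\<lambda>z. z powr \<alpha>) Z"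
    unfolding R_def Y_def matfun_compose[OF hZ] matfun_mult[OF hZ]
  proof (rule matfun_cong[OF Z])
    fix z :: real assume z: "0 \<le> z"
    have "1 - 1 / (1 + z) = z / (1 + z)" using z by (simp add: field_simps)
    moreover have "sqrt (1 + z) * x * sqrt (1 + z) = (1 + z) * x" for x
    proof -
      have "sqrt (1 + z) * x * sqrt (1 + z) = (sqrt (1 + z) * sqrt (1 + z)) * x" by (simp only: mult_ac)
      then show ?thesis using z by simp
    qed
    ultimately have "sqrt (1 + z) * ?h (1 / (1 + z)) * sqrt (1 + z)
      = (1 + z) * ((1 / (1 + z)) powr (1 - \<alpha>) * (z / (1 + z)) powr \<alpha>)"
      by presburger
    also have "\<dots> = (1 + z) * (z powr \<alpha> / ((1 + z) powr (1 - \<alpha>) * (1 + z) powr \<alpha>))"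
      using z by (simp add: powr_divide)
    also have "(1 + z) powr (1 - \<alpha>) * (1 + z) powr \<alpha> = 1 + z"
      using z by (simp add: powr_add[symmetric])
    also have "(1 + z) * (z powr \<alpha> / (1 + z)) = z powr \<alpha>" using z by simp
    finally show "sqrt (1 + z) * ?h (1 / (1 + z)) * sqrt (1 + z) = z powr \<alpha>" .
  qed
  finally show ?thesis
    unfolding gmean_pd_def H_def[symmetric] Hi_def[symmetric] Z_def[symmetric] mpow_def[of Z] by simp
qed

text \<open>Inversion turns the congruence by \<open>Q\<close> into one by \<open>R\<close>, so the
  averaged inverse is \<open>R ** matfun ?n T ** R\<close>; inverting again restores
  \<open>Q\<close> and replaces the scalar function by its reciprocal.\<close>

lemma hmean_pd_eq:
  fixes A B :: "'n::finite cmat"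
  assumes A: "pd A" and B: "pd B" and \<alpha>: "0 < \<alpha>" "\<alpha> < 1"
  shows "hmean_pd \<alpha> A B = sum_sqrt A B ** matfun (\<lambda>t. t * (1 - t) / ((1 - \<alpha>) * (1 - t) + \<alpha> * t)) (share A B) ** sum_sqrt A B"
proof -
  note f = sum_sqrt_facts[OF A B] and s = share_facts[OF A B]
  define Q R T where "Q = sum_sqrt A B" and "R = sum_rsqrt A B" and "T = share A B"
  have QR: "Q ** R = mat 1" "R ** Q = mat 1" using f by (simp_all add: Q_def R_def)
  have QR': "Q ** (R ** M) = M" "R ** (Q ** M) = M" for M by (simp_all add: matrix_mul_assoc QR)
  have T: "pd T" "pd (mat 1 - T)" using s by (simp_all add: T_def)
  note hT = pd_hermitian[OF T(1)]
  have A_eq: "A = Q ** T ** Q" and B_eq: "B = Q ** (mat 1 - T) ** Q"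
    using s by (simp_all add: Q_def T_def)
  have g1: "matfun (\<lambda>t. 1 / t) T = ginv T"
    unfolding ginv_def by (rule matfun_cong_pd[OF T(1)]) simp
  have m1: "mat 1 - T = matfun (\<lambda>t. 1 - t) T"
    by (simp add: matfun_diff[OF hT, symmetric] matfun_one matfun_ident hT)
  have "T ** matfun (\<lambda>t. 1 / t) T = matfun (\<lambda>t. t) T ** matfun (\<lambda>t. 1 / t) T"
    by (simp add: matfun_ident hT)
  also have "\<dots> = matfun (\<lambda>t. 1) T"
    unfolding matfun_mult[OF hT] by (rule matfun_cong_pd[OF T(1)]) simp
  finally have T1: "T ** matfun (\<lambda>t. 1 / t) T = mat 1" by (simp add: matfun_one hT)
  have "(mat 1 - T) ** matfun (\<lambda>t. 1 / (1 - t)) T = matfun (\<lambda>t. 1) T"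
    unfolding m1 matfun_mult[OF hT] by (rule matfun_cong_pd_between[OF T]) simp
  then have T2: "(mat 1 - T) ** matfun (\<lambda>t. 1 / (1 - t)) T = mat 1" by (simp add: matfun_one hT)
  have gA: "ginv A = R ** matfun (\<lambda>t. 1 / t) T ** R"
  proof (rule ginv_eqI[OF A])
    have "A ** (R ** matfun (\<lambda>t. 1 / t) T ** R) = Q ** (T ** matfun (\<lambda>t. 1 / t) T) ** R"
      by (simp add: A_eq matrix_mul_assoc[symmetric] QR')
    then show "A ** (R ** matfun (\<lambda>t. 1 / t) T ** R) = mat 1" by (simp add: T1 QR)
  qed
  have gB: "ginv B = R ** matfun (\<lambda>t. 1 / (1 - t)) T ** R"
  proof (rule ginv_eqI[OF B])
    have "B ** (R ** matfun (\<lambda>t. 1 / (1 - t)) T ** R) = Q ** ((mat 1 - T) ** matfun (\<lambda>t. 1 / (1 - t)) T) ** R"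
      by (simp add: B_eq matrix_mul_assoc[symmetric] QR')
    then show "B ** (R ** matfun (\<lambda>t. 1 / (1 - t)) T ** R) = mat 1" by (simp add: T2 QR)
  qed
  let ?n = "\<lambda>t. (1 - \<alpha>) * (1 / t) + \<alpha> * (1 / (1 - t))"
  let ?k = "\<lambda>t. t * (1 - t) / ((1 - \<alpha>) * (1 - t) + \<alpha> * t)"
  have N: "(1 - \<alpha>) *\<^sub>R ginv A + \<alpha> *\<^sub>R ginv B = R ** matfun ?n T ** R"
    unfolding gA gB matfun_add[OF hT, symmetric] matfun_scaleR[OF hT, symmetric]
    by (simp add: mm.add_left mm.add_right mm.scaleR_left mm.scaleR_right)
  show ?thesis
    unfolding hmean_pd_def Q_def[symmetric] T_def[symmetric]
  proof (rule ginv_eqI)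
    show "pd ((1 - \<alpha>) *\<^sub>R ginv A + \<alpha> *\<^sub>R ginv B)"
      using \<alpha> A B by (intro pd_add pd_scaleR pd_ginv) auto
    have "R ** matfun ?n T ** R ** (Q ** matfun ?k T ** Q) = R ** (matfun ?n T ** matfun ?k T) ** Q"
      by (simp add: matrix_mul_assoc[symmetric] QR')
    also have "matfun ?n T ** matfun ?k T = matfun (\<lambda>t. 1) T"
      unfolding matfun_mult[OF hT]
    proof (rule matfun_cong_pd_between[OF T])
      fix t :: real assume t: "0 < t" "t < 1"
      have "(1 - \<alpha>) * (1 - t) + \<alpha> * t > 0" using t \<alpha> by (intro add_pos_pos mult_pos_pos) auto
      moreover have "?n t = ((1 - \<alpha>) * (1 - t) + \<alpha> * t) / (t * (1 - t))"
        using t by (simp add: add_divide_distrib)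
      ultimately show "?n t * ?k t = 1" using t by simp
    qed
    finally show "((1 - \<alpha>) *\<^sub>R ginv A + \<alpha> *\<^sub>R ginv B) ** (Q ** matfun ?k T ** Q) = mat 1"
      unfolding N by (simp add: matfun_one hT QR)
  qed
qed

section \<open>Removing the regularization\<close>

lemma matfun_add_scaled_id:
  assumes "hermitian A"
  shows "A + e *\<^sub>R mat 1 = matfun (\<lambda>x. x + e) A" 
    "matfun f (A + e *\<^sub>R mat 1) = matfun (\<lambda>x. f (x + e)) A"
proof -
  have "matfun (\<lambda>x. x + e) A = matfun (\<lambda>x. x) A + e *\<^sub>R matfun (\<lambda>x. 1) A"
    by (simp only: matfun_add[OF assms] matfun_scaleR[OF assms]) simp
  then show 1: "A + e *\<^sub>R mat 1 = matfun (\<lambda>x. x + e) A"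
    by (simp only: matfun_ident[OF assms] matfun_one[OF assms])
  show "matfun f (A + e *\<^sub>R mat 1) = matfun (\<lambda>x. f (x + e)) A"
    unfolding 1 matfun_compose[OF assms] ..
qed

lemma add_scaled_id_add:
  "(A + e *\<^sub>R mat 1) + (B + e *\<^sub>R mat 1) = (A + B :: 'n::finite cmat) + (2 * e) *\<^sub>R mat 1"
  by (simp add: algebra_simps flip: scaleR_2)

lemma sum_sqrt_tendsto:
  fixes A B :: "'n::finite cmat"
  assumes A: "psd A" and B: "psd B"
  shows "((\<lambda>e. sum_sqrt (A + e *\<^sub>R mat 1) (B + e *\<^sub>R mat 1)) \<longlongrightarrow> sum_sqrt A B) (at_right 0)"
proof -
  have C: "psd (A + B)" using A B by (rule psd_add)
  have "sum_sqrt (A + e *\<^sub>R mat 1) (B + e *\<^sub>R mat 1) = matfun (\<lambda>x. sqrt (x + 2 * e)) (A + B)" for e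
    unfolding sum_sqrt_def add_scaled_id_add matfun_add_scaled_id(2)[OF psd_hermitian[OF C]] ..
  moreover have "((\<lambda>e. matfun (\<lambda>x. sqrt (x + 2 * e)) (A + B)) \<longlongrightarrow> matfun (\<lambda>x. sqrt x) (A + B)) (at_right 0)"
    by (rule matfun_tendsto_pointwise[OF C]) (auto intro!: tendsto_eq_intros)
  ultimately show ?thesis by (simp add: sum_sqrt_def)
qed

text \<open>The inverse root of the regularized sum blows up on the kernel of \<open>A + B\<close>,
  but \<open>A\<close> vanishes there, since two nonnegative forms with sum 0 are both 0. Hence
  \<open>A = P ** A ** P\<close> absorbs the singular part.\<close>

lemma share_convergent:
  fixes A B :: "'n::finite cmat"
  assumes A: "psd A" and B: "psd B"
  shows "\<exists>T. ((\<lambda>e. share (A + e *\<^sub>R mat 1) (B + e *\<^sub>R mat 1)) \<longlongrightarrow> T) (at_right 0)"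
proof -
  define C where "C = A + B"
  have C: "psd C" unfolding C_def using A B by (rule psd_add)
  note hC = psd_hermitian[OF C]
  define P where "P = matfun (\<lambda>x. if x = 0 then 0 else 1) C"
  have hP: "hermitian P" by (simp add: P_def hC)
  have "C ** (mat 1 - P) = matfun (\<lambda>x. x) C ** (matfun (\<lambda>x. 1) C - P)"
    by (simp only: matfun_ident[OF hC] matfun_one[OF hC])
  also have "\<dots> = matfun (\<lambda>x. 0) C"
    unfolding P_def matfun_diff[OF hC] matfun_mult[OF hC] by (rule matfun_cong[OF C]) simp
  finally have CP: "C ** (mat 1 - P) = 0" by (simp add: matfun_zero hC)
  have "A ** (mat 1 - P) = 0"
    unfolding matrix_eq
  proof
    fix v
    define w where "w = (mat 1 - P) *v v"
    have "C *v w = 0" by (simp add: w_def matrix_vector_mul_assoc CP)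
    then have "w \<bullet> (A *v w) + w \<bullet> (B *v w) = 0"
      by (metis C_def inner_add_right inner_zero_right mv.add_left)
    moreover have "0 \<le> w \<bullet> (A *v w)" "0 \<le> w \<bullet> (B *v w)" using A B by (auto simp: psd_iff)
    ultimately have "w \<bullet> (A *v w) = 0" by linarith
    then have "A *v w = 0" by (rule psd_kernel[OF A])
    then show "A ** (mat 1 - P) *v v = 0 *v v" by (simp add: w_def matrix_vector_mul_assoc)
  qed
  then have AP: "A = A ** P" by (simp add: mm.diff_right)
  then have PA: "A = P ** A" by (metis A hP hermitian_def madj_mult psd_hermitian)
  have PAP: "A = P ** A ** P" using AP PA by (metis matrix_mul_assoc)
  \<comment> \<open>The inverse root with its kernel part cut off, which does converge as
    \<open>e\<close> tends to 0.\<close>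
  define g where "g = (\<lambda>(e::real) x. (if x = 0 then 0 else 1) / sqrt (x + 2 * e))"
  have eq: "share (A + e *\<^sub>R mat 1) (B + e *\<^sub>R mat 1)
     = matfun (g e) C ** A ** matfun (g e) C + matfun (\<lambda>x. e / (x + 2 * e)) C" if "e > 0" for e
  proof -
    let ?R = "matfun (\<lambda>x. 1 / sqrt (x + 2 * e)) C"
    have R: "sum_rsqrt (A + e *\<^sub>R mat 1) (B + e *\<^sub>R mat 1) = ?R"
      unfolding sum_rsqrt_def add_scaled_id_add C_def[symmetric] matfun_add_scaled_id(2)[OF hC] ..
    have "?R ** A ** ?R = (?R ** P) ** A ** (P ** ?R)"
      by (metis PAP matrix_mul_assoc)
    also have "?R ** P = matfun (g e) C" by (simp add: P_def matfun_mult[OF hC] g_def)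
    also have "P ** ?R = matfun (g e) C" by (simp add: P_def matfun_mult[OF hC] g_def)
    finally have 1: "?R ** A ** ?R = matfun (g e) C ** A ** matfun (g e) C" .
    have "?R ** (e *\<^sub>R mat 1) ** ?R = e *\<^sub>R (?R ** ?R)"
      by (simp add: mm.scaleR_left mm.scaleR_right)
    also have "\<dots> = matfun (\<lambda>x. e / (x + 2 * e)) C"
      unfolding matfun_mult[OF hC] matfun_scaleR[OF hC]
      by (rule matfun_cong[OF C]) (use that in simp)
    finally show ?thesis unfolding share_def R by (simp add: mm.add_left mm.add_right 1)
  qed
  have l1: "((\<lambda>e. matfun (g e) C) \<longlongrightarrow> matfun (g 0) C) (at_right 0)"
    by (rule matfun_tendsto_pointwise[OF C]) (auto simp: g_def intro!: tendsto_eq_intros)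
  \<comment> \<open>On the kernel of \<open>A + B\<close> only the two equal regularizing terms are
    left, so the share is \<open>e / (2 * e)\<close>, the value \<open>1 / 2\<close>.\<close>
  have l2: "((\<lambda>e. matfun (\<lambda>x. e / (x + 2 * e)) C) \<longlongrightarrow> matfun (\<lambda>x. if x = 0 then 1 / 2 else 0) C) (at_right 0)"
  proof (rule matfun_tendsto_pointwise[OF C])
    fix x :: real assume "0 \<le> x"
    show "((\<lambda>e. e / (x + 2 * e)) \<longlongrightarrow> (if x = 0 then 1 / 2 else 0)) (at_right 0)"
    proof (cases "x = 0")
      case True
      have "\<forall>\<^sub>F e in at_right 0. 1 / 2 = e / (x + 2 * e)"
        by (rule eventually_mono[OF eventually_at_right_less[of "0::real"]]) (simp add: True)
      then show ?thesis
        using True by (intro Lim_transform_eventually[OF tendsto_const]) auto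
    qed (use \<open>0 \<le> x\<close> in \<open>auto intro!: tendsto_eq_intros\<close>)
  qed
  have "((\<lambda>e. matfun (g e) C ** A ** matfun (g e) C + matfun (\<lambda>x. e / (x + 2 * e)) C) \<longlongrightarrow>
     matfun (g 0) C ** A ** matfun (g 0) C + matfun (\<lambda>x. if x = 0 then 1 / 2 else 0) C) (at_right 0)"
    by (intro tendsto_add mm.tendsto l1 l2 tendsto_const)
  then show ?thesis
    by (intro exI) (erule Lim_transform_eventually, 
      auto simp: eq intro: eventually_mono[OF eventually_at_right_less[of "0::real"]])
qed

text \<open>
  The last clause is a lower bound that is affine in the generalized inverses: it comes from
  \<open>N\<^sup>-\<^sup>1 \<ge> 2 - N\<close> applied to the inverse \<open>N\<close> of the harmonic mean.
\<close>

definition between_means :: "real \<Rightarrow> 'n::finite cmat \<Rightarrow> 'n cmat \<Rightarrow> 'n cmat \<Rightarrow> bool" where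
  "between_means \<alpha> A B X \<longleftrightarrow> psd X \<and>
     (\<forall>v. A *v v = 0 \<or> B *v v = 0 \<longrightarrow> X *v v = 0) \<and>
     psd ((1 - \<alpha>) *\<^sub>R A + \<alpha> *\<^sub>R B - X) \<and>
     (\<forall>P. hermitian P \<and> P ** P = P \<and> supp A ** P = P \<and> supp B ** P = P \<longrightarrow>
        psd (P ** X ** P - (2 *\<^sub>R P - (1 - \<alpha>) *\<^sub>R (P ** ginv A ** P) - \<alpha> *\<^sub>R (P ** ginv B ** P))))"

lemma psd_trans_diff: "psd (X - Y) \<Longrightarrow> psd (Y - Z) \<Longrightarrow> psd (X - Z)"
  using psd_add[of "X - Y" "Y - Z"] by simp

text \<open>On a nonzero kernel of \<open>A\<close> the uncompressed inequality fails:
  \<open>ginv A\<close> is 0 there, the regularized inverse is \<open>1 / e\<close>. Under a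
  \<open>P\<close> below \<open>supp A\<close> only eigenvalues \<open>x > 0\<close> count, where
  \<open>1 / (x + e) \<le> 1 / x\<close>.\<close>

lemma ginv_add_scaled_id_le:
  assumes A: "psd A" and e: "0 < e" and P: "hermitian P" "supp A ** P = P"
  shows "psd (P ** ginv A ** P - P ** ginv (A + e *\<^sub>R mat 1) ** P)"
proof -
  note hA = psd_hermitian[OF A]
  have P': "P ** supp A = P"
    using P hA by (metis hermitian_def hermitian_matfun madj_mult supp_def)
  have "P ** M ** P = P ** (supp A ** M ** supp A) ** P" for M
    by (metis P' P(2) matrix_mul_assoc)
  then have "P ** ginv A ** P - P ** ginv (A + e *\<^sub>R mat 1) ** P
    = P ** (supp A ** (ginv A - ginv (A + e *\<^sub>R mat 1)) ** supp A) ** P"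
    by (simp only: mm.diff_left[symmetric] mm.diff_right[symmetric])
  also have "supp A ** (ginv A - ginv (A + e *\<^sub>R mat 1)) ** supp A =
     matfun (\<lambda>x. (if x = 0 then 0 else 1) * ((if x = 0 then 0 else 1 / x) - (if x + e = 0 then 0 else 1 / (x + e))) * (if x = 0 then 0 else 1)) A"
    unfolding supp_def ginv_def matfun_add_scaled_id(2)[OF hA] matfun_diff[OF hA] matfun_mult[OF hA] ..
  finally have eq: "P ** ginv A ** P - P ** ginv (A + e *\<^sub>R mat 1) ** P = P ** \<dots> ** P" .
  show ?thesis
    unfolding eq
    by (intro psd_conj_hermitian[OF _ P(1)] psd_matfun[OF A]) (use e in \<open>auto intro: divide_left_mono\<close>)
qed

text \<open>The constant 2 belongs to the tangent \<open>2 - x\<close> of \<open>1 / x\<close> at 1,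
  so nothing of first order is lost near \<open>N = mat 1\<close>. The inverse of a compressed
  matrix never has to be formed.\<close>

lemma hmean_pd_lower_bound:
  fixes A B :: "'n::finite cmat"
  assumes A: "pd A" and B: "pd B" and \<alpha>: "0 < \<alpha>" "\<alpha> < 1" and P: "hermitian P" "P ** P = P"
  shows "psd (P ** hmean_pd \<alpha> A B ** P - (2 *\<^sub>R P - (1 - \<alpha>) *\<^sub>R (P ** ginv A ** P) - \<alpha> *\<^sub>R (P ** ginv B ** P)))"
proof -
  define N where "N = (1 - \<alpha>) *\<^sub>R ginv A + \<alpha> *\<^sub>R ginv B"
  have pdN: "pd N" unfolding N_def using A B \<alpha> by (intro pd_add pd_scaleR pd_ginv) auto
  note hN = pd_hermitian[OF pdN]
  have "ginv N + N - 2 *\<^sub>R mat 1 = matfun (\<lambda>x. (if x = 0 then 0 else 1 / x) + x - 2 * 1) N"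
    unfolding matfun_diff[OF hN, symmetric] matfun_add[OF hN, symmetric] matfun_scaleR[OF hN, symmetric]
      matfun_ident[OF hN] matfun_one[OF hN] ginv_def ..
  moreover have "psd (matfun (\<lambda>x. (if x = 0 then 0 else 1 / x) + x - 2 * 1) N)"
  proof (rule psd_matfun_pd[OF pdN])
    fix x :: real assume x: "0 < x"
    have "1 / x + x - 2 = (x - 1)\<^sup>2 / x" using x by (simp add: power2_eq_square field_simps)
    also have "\<dots> \<ge> 0" using x by simp
    finally show "0 \<le> (if x = 0 then 0 else 1 / x) + x - 2 * 1" using x by simp
  qed
  ultimately have "psd (ginv N + N - 2 *\<^sub>R mat 1)" by simp
  then have "psd (P ** (ginv N + N - 2 *\<^sub>R mat 1) ** P)" by (rule psd_conj_hermitian[OF _ P(1)])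
  also have "P ** (ginv N + N - 2 *\<^sub>R mat 1) ** P = P ** hmean_pd \<alpha> A B ** P - (2 *\<^sub>R P - (1 - \<alpha>) *\<^sub>R (P ** ginv A ** P) - \<alpha> *\<^sub>R (P ** ginv B ** P))"
    unfolding N_def hmean_pd_def
    by (simp add: mm.add_left mm.add_right mm.diff_left mm.diff_right mm.scaleR_left mm.scaleR_right P(2))
  finally show ?thesis .
qed

lemma young_powr:
  fixes s t \<alpha> :: real
  assumes "0 < \<alpha>" "\<alpha> < 1" "0 \<le> s" "0 \<le> t"
  shows "s powr (1 - \<alpha>) * t powr \<alpha> \<le> (1 - \<alpha>) * s + \<alpha> * t"
proof (cases "s = 0 \<or> t = 0")
  case False
  then show ?thesis using Youngs_inequality_0[of "1 - \<alpha>" \<alpha> s t] assms by simp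
qed (use assms in auto)

text \<open>The geometric mean times its dual
  \<open>(1 - t) powr (1 - \<alpha>) * t powr \<alpha>\<close> is \<open>t * (1 - t)\<close>;
  Young's inequality bounds the dual by the denominator, which gives the harmonic bound.\<close>

lemma hm_gm_am:
  fixes t \<alpha> :: real
  assumes \<alpha>: "0 < \<alpha>" "\<alpha> < 1" and t: "0 \<le> t" "t \<le> 1"
  shows "t * (1 - t) / ((1 - \<alpha>) * (1 - t) + \<alpha> * t) \<le> t powr (1 - \<alpha>) * (1 - t) powr \<alpha>"
    and "t powr (1 - \<alpha>) * (1 - t) powr \<alpha> \<le> (1 - \<alpha>) * t + \<alpha> * (1 - t)"
    and "0 < (1 - \<alpha>) * (1 - t) + \<alpha> * t"
proof -
  show "t powr (1 - \<alpha>) * (1 - t) powr \<alpha> \<le> (1 - \<alpha>) * t + \<alpha> * (1 - t)"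
    using young_powr[OF \<alpha>, of t "1 - t"] t by simp
  show pos: "0 < (1 - \<alpha>) * (1 - t) + \<alpha> * t"
  proof (cases "t = 0")
    case False
    then show ?thesis using \<alpha> t by (intro add_nonneg_pos mult_pos_pos mult_nonneg_nonneg) auto
  qed (use \<alpha> in auto)
  have "t * (1 - t) = (t powr (1 - \<alpha>) * t powr \<alpha>) * ((1 - t) powr \<alpha> * (1 - t) powr (1 - \<alpha>))"
    using t by (simp add: powr_add[symmetric])
  also have "\<dots> = (t powr (1 - \<alpha>) * (1 - t) powr \<alpha>) * ((1 - t) powr (1 - \<alpha>) * t powr \<alpha>)" by simp
  also have "\<dots> \<le> (t powr (1 - \<alpha>) * (1 - t) powr \<alpha>) * ((1 - \<alpha>) * (1 - t) + \<alpha> * t)"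
    using young_powr[OF \<alpha>, of "1 - t" t] t by (intro mult_left_mono) auto
  finally show "t * (1 - t) / ((1 - \<alpha>) * (1 - t) + \<alpha> * t) \<le> t powr (1 - \<alpha>) * (1 - t) powr \<alpha>"
    using pos by (simp add: divide_le_eq)
qed

text \<open>Treats both means at once and shows that the \<open>Lim\<close> in their definitions is
  a genuine limit. The conditions \<open>f 0 = 0\<close> and \<open>f 1 = 0\<close> are what makes
  the mean vanish on the kernels of \<open>A\<close> and \<open>B\<close>.\<close>

lemma mean_limit_between_means:
  fixes A B :: "'n::finite cmat" and M :: "'n cmat \<Rightarrow> 'n cmat \<Rightarrow> 'n cmat"
  assumes A: "psd A" and B: "psd B" and \<alpha>: "0 < \<alpha>" "\<alpha> < 1"
    and f: "continuous_on {0..1} f" "f 0 = 0" "f 1 = 0"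
    and lower: "\<And>t. 0 \<le> t \<Longrightarrow> t \<le> 1 \<Longrightarrow> t * (1 - t) / ((1 - \<alpha>) * (1 - t) + \<alpha> * t) \<le> f t"
    and upper: "\<And>t. 0 \<le> t \<Longrightarrow> t \<le> 1 \<Longrightarrow> f t \<le> (1 - \<alpha>) * t + \<alpha> * (1 - t)"
    and M: "\<And>A B. pd A \<Longrightarrow> pd B \<Longrightarrow> M A B = sum_sqrt A B ** matfun f (share A B) ** sum_sqrt A B"
  shows "between_means \<alpha> A B (Lim (at_right 0) (\<lambda>e. M (A + e *\<^sub>R mat 1) (B + e *\<^sub>R mat 1)))"
proof -
  define Ae Be where "Ae = (\<lambda>e::real. A + e *\<^sub>R mat 1)" and "Be = (\<lambda>e::real. B + e *\<^sub>R mat 1)"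
  have pd: "pd (Ae e)" "pd (Be e)" if "e > 0" for e
    using pd_add_scaled_id A B that by (auto simp: Ae_def Be_def)
  define Q where "Q = sum_sqrt A B"
  have Qe: "((\<lambda>e. sum_sqrt (Ae e) (Be e)) \<longlongrightarrow> Q) (at_right 0)"
    unfolding Ae_def Be_def Q_def by (rule sum_sqrt_tendsto[OF A B])
  obtain T where Te: "((\<lambda>e. share (Ae e) (Be e)) \<longlongrightarrow> T) (at_right 0)"
    using share_convergent[OF A B] by (auto simp: Ae_def Be_def)
  have ev: "\<forall>\<^sub>F e in at_right 0. R e" if "\<And>e. 0 < e \<Longrightarrow> R e" for R :: "real \<Rightarrow> bool"
    using that by (rule eventually_mono[OF eventually_at_right_less[of "0::real"]])
  have hQ: "hermitian Q" by (simp add: Q_def sum_sqrt_def psd_add A B psd_hermitian)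
  have T: "psd T"
    by (rule psd_closed[OF Te ev]) (auto intro!: pd_imp_psd share_facts pd)
  have T1: "psd (mat 1 - T)"
    by (rule psd_closed[OF tendsto_diff[OF tendsto_const Te] ev]) (auto intro!: pd_imp_psd share_facts pd)
  have Al: "(Ae \<longlongrightarrow> A) (at_right 0)" and Bl: "(Be \<longlongrightarrow> B) (at_right 0)"
    unfolding Ae_def Be_def by (auto intro!: tendsto_eq_intros)
  have QTQ: "Q ** T ** Q = A"
  proof (rule tendsto_unique[OF _ _ Al])
    show "(Ae \<longlongrightarrow> Q ** T ** Q) (at_right 0)"
      by (rule Lim_transform_eventually[OF mm.tendsto[OF mm.tendsto[OF Qe Te] Qe]])
        (use ev share_facts(3)[OF pd] in auto)
  qed auto
  have QTQ': "Q ** (mat 1 - T) ** Q = B"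
  proof (rule tendsto_unique[OF _ _ Bl])
    show "(Be \<longlongrightarrow> Q ** (mat 1 - T) ** Q) (at_right 0)"
      by (rule Lim_transform_eventually[OF mm.tendsto[OF mm.tendsto[OF Qe tendsto_diff[OF tendsto_const Te]] Qe]])
        (use ev share_facts(4)[OF pd] in auto)
  qed auto
  define X where "X = Q ** matfun f T ** Q"
  have "((\<lambda>e. matfun f (share (Ae e) (Be e))) \<longlongrightarrow> matfun f T) (at_right 0)"
    by (rule matfun_tendsto_le_1[OF f(1) _ _ Te]) (auto intro!: pd_imp_psd share_facts pd)
  then have "((\<lambda>e. sum_sqrt (Ae e) (Be e) ** matfun f (share (Ae e) (Be e)) ** sum_sqrt (Ae e) (Be e)) \<longlongrightarrow> X) (at_right 0)"
    unfolding X_def by (intro mm.tendsto Qe)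
  then have Xl: "((\<lambda>e. M (Ae e) (Be e)) \<longlongrightarrow> X) (at_right 0)"
    by (rule Lim_transform_eventually) (use ev M[OF pd] in auto)
  then have LimX: "Lim (at_right 0) (\<lambda>e. M (A + e *\<^sub>R mat 1) (B + e *\<^sub>R mat 1)) = X"
    by (simp add: tendsto_Lim Ae_def Be_def)
  note hT = psd_hermitian[OF T]
  have f0: "0 \<le> f t" if "0 \<le> t" "t \<le> 1" for t
  proof -
    have "0 \<le> t * (1 - t) / ((1 - \<alpha>) * (1 - t) + \<alpha> * t)"
      using that hm_gm_am(3)[OF \<alpha> that] by (intro divide_nonneg_pos mult_nonneg_nonneg) auto
    then show ?thesis using lower[OF that] by linarith
  qed
  have psdX: "psd X"
    unfolding X_def by (intro psd_conj_hermitian hQ psd_matfun_le_1 T T1 f0)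
  \<comment> \<open>A vector of the kernel of \<open>A\<close> or \<open>B\<close> is sent by
    \<open>Q\<close> into the eigenspace of \<open>T\<close> for 0 or 1 respectively, and
    \<open>f\<close> vanishes at both.\<close>
  have ker: "X *v v = 0" if "A *v v = 0 \<or> B *v v = 0" for v
  proof -
    have "matfun f T *v (Q *v v) = 0" using that
    proof
      assume "A *v v = 0"
      then have "(Q *v v) \<bullet> (T *v (Q *v v)) = 0"
        unfolding QTQ[symmetric] hermitian_inner[OF hQ] by (simp add: matrix_vector_mul_assoc matrix_mul_assoc)
      then have "T *v (Q *v v) = 0 *\<^sub>R (Q *v v)" using psd_kernel[OF T] by simp
      from eigenvector_matfun[OF hT this, of f] show ?thesis by (simp add: f)
    next
      assume "B *v v = 0"
      then have "(Q *v v) \<bullet> ((mat 1 - T) *v (Q *v v)) = 0"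
        unfolding QTQ'[symmetric] hermitian_inner[OF hQ] by (simp add: matrix_vector_mul_assoc matrix_mul_assoc)
      then have "(mat 1 - T) *v (Q *v v) = 0" by (rule psd_kernel[OF T1])
      then have "T *v (Q *v v) = 1 *\<^sub>R (Q *v v)" by (simp add: mv.diff_left)
      from eigenvector_matfun[OF hT this, of f] show ?thesis by (simp add: f)
    qed
    then show ?thesis by (simp add: X_def matrix_vector_mul_assoc[symmetric])
  qed
  have up: "psd ((1 - \<alpha>) *\<^sub>R A + \<alpha> *\<^sub>R B - X)"
  proof -
    have "psd (matfun (\<lambda>t. (1 - \<alpha>) * t + \<alpha> * (1 - t) - f t) T)"
      by (rule psd_matfun_le_1[OF T T1]) (use upper in auto)
    then have "psd (Q ** matfun (\<lambda>t. (1 - \<alpha>) * t + \<alpha> * (1 - t) - f t) T ** Q)"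
      by (rule psd_conj_hermitian[OF _ hQ])
    also have "matfun (\<lambda>t. (1 - \<alpha>) * t + \<alpha> * (1 - t) - f t) T = (1 - \<alpha>) *\<^sub>R T + \<alpha> *\<^sub>R (mat 1 - T) - matfun f T"
      by (simp only: matfun_diff[OF hT, symmetric] matfun_add[OF hT, symmetric] matfun_scaleR[OF hT, symmetric]
          matfun_ident[OF hT] matfun_one[OF hT])
    also have "Q ** \<dots> ** Q = (1 - \<alpha>) *\<^sub>R (Q ** T ** Q) + \<alpha> *\<^sub>R (Q ** (mat 1 - T) ** Q) - X"
      by (simp only: X_def mm.diff_right mm.diff_left mm.add_right mm.add_left mm.scaleR_left mm.scaleR_right)
    finally show ?thesis unfolding QTQ QTQ' .
  qed
  \<comment> \<open>For \<open>e > 0\<close> the chain is: \<open>M\<close> above the harmonic mean,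
    above the affine bound with regularized inverses, above the one with \<open>ginv A\<close> and
    \<open>ginv B\<close>. The last is independent of \<open>e\<close>, so it passes to the
    limit.\<close>
  have low: "psd (P ** X ** P - (2 *\<^sub>R P - (1 - \<alpha>) *\<^sub>R (P ** ginv A ** P) - \<alpha> *\<^sub>R (P ** ginv B ** P)))"
    if P: "hermitian P" "P ** P = P" "supp A ** P = P" "supp B ** P = P" for P
  proof (rule psd_closed)
    let ?L = "2 *\<^sub>R P - (1 - \<alpha>) *\<^sub>R (P ** ginv A ** P) - \<alpha> *\<^sub>R (P ** ginv B ** P)"
    show "((\<lambda>e. P ** M (Ae e) (Be e) ** P - ?L) \<longlongrightarrow> P ** X ** P - ?L) (at_right 0)"
      by (intro tendsto_diff mm.tendsto tendsto_const Xl)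
    have "psd (P ** M (Ae e) (Be e) ** P - ?L)" if e: "0 < e" for e
    proof (rule psd_trans_diff)
      let ?Q = "sum_sqrt (Ae e) (Be e)" and ?T = "share (Ae e) (Be e)"
      let ?k = "\<lambda>t. t * (1 - t) / ((1 - \<alpha>) * (1 - t) + \<alpha> * t)"
      note sf = share_facts[OF pd[OF e]]
      have "psd (matfun (\<lambda>t. f t - ?k t) ?T)"
        by (rule psd_matfun_le_1[OF sf(1,2)[THEN pd_imp_psd]]) (use lower in auto)
      then have "psd (P ** (?Q ** matfun (\<lambda>t. f t - ?k t) ?T ** ?Q) ** P)"
        by (intro psd_conj_hermitian P sum_sqrt_facts pd e)
      also have "P ** (?Q ** matfun (\<lambda>t. f t - ?k t) ?T ** ?Q) ** P =
         P ** M (Ae e) (Be e) ** P - P ** hmean_pd \<alpha> (Ae e) (Be e) ** P"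
        unfolding M[OF pd[OF e]] hmean_pd_eq[OF pd[OF e] \<alpha>] matfun_diff[OF pd_hermitian[OF sf(1)], symmetric]
        by (simp only: mm.diff_right mm.diff_left)
      finally show "psd (P ** M (Ae e) (Be e) ** P - P ** hmean_pd \<alpha> (Ae e) (Be e) ** P)" .
      have 1: "psd ((1 - \<alpha>) *\<^sub>R (P ** ginv A ** P - P ** ginv (Ae e) ** P) + \<alpha> *\<^sub>R (P ** ginv B ** P - P ** ginv (Be e) ** P))"
        using \<alpha> unfolding Ae_def Be_def
        by (intro psd_add psd_scaleR ginv_add_scaled_id_le A B e P) auto
      show "psd (P ** hmean_pd \<alpha> (Ae e) (Be e) ** P - ?L)"
        using psd_add[OF hmean_pd_lower_bound[OF pd[OF e] \<alpha> P(1,2)] 1] by (simp add: algebra_simps)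
    qed
    then show "\<forall>\<^sub>F e in at_right 0. psd (P ** M (Ae e) (Be e) ** P - ?L)" by (rule ev)
  qed auto
  show ?thesis
    unfolding LimX between_means_def using psdX ker up low by blast
qed

lemma gmean_between_means:
  assumes "psd A" "psd B" and \<alpha>: "0 < \<alpha>" "\<alpha> < 1"
  shows "between_means \<alpha> A B (gmean \<alpha> A B)"
  unfolding gmean_def
proof (rule mean_limit_between_means[OF assms, where f = "\<lambda>t. t powr (1 - \<alpha>) * (1 - t) powr \<alpha>"])
  show "continuous_on {0..1} (\<lambda>t. t powr (1 - \<alpha>) * (1 - t) powr \<alpha>)"
    using \<alpha> by (intro continuous_on_mult continuous_on_powr' continuous_intros) auto
qed (use \<alpha> hm_gm_am gmean_pd_eq in auto)

lemma hmean_between_means: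
  assumes "psd A" "psd B" and \<alpha>: "0 < \<alpha>" "\<alpha> < 1"
  shows "between_means \<alpha> A B (hmean \<alpha> A B)"
  unfolding hmean_def
proof (rule mean_limit_between_means[OF assms, where f = "\<lambda>t. t * (1 - t) / ((1 - \<alpha>) * (1 - t) + \<alpha> * t)"])
  have "(1 - \<alpha>) * (1 - t) + \<alpha> * t \<noteq> 0" if "t \<in> {0..1}" for t
    using hm_gm_am(3)[OF \<alpha>, of t] that by simp
  then show "continuous_on {0..1} (\<lambda>t. t * (1 - t) / ((1 - \<alpha>) * (1 - t) + \<alpha> * t))"
    by (intro continuous_intros) blast
qed (use \<alpha> hm_gm_am[OF \<alpha>] hmean_pd_eq in \<open>auto intro: order_trans\<close>)

subsection \<open>Projections and their meet\<close>

definition projection :: "'n::finite cmat \<Rightarrow> bool" where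
  "projection P \<longleftrightarrow> hermitian P \<and> P ** P = P"

lemma projection_range: "projection P \<Longrightarrow> range ((*v) P) = {v. P *v v = v}"
  by (auto simp: projection_def matrix_vector_mul_assoc) (metis rangeI)

lemma projection_unique:
  assumes P: "projection P" and Q: "projection Q" and eq: "range ((*v) P) = range ((*v) Q)"
  shows "P = Q"
proof -
  have "Q ** P = P"
    unfolding matrix_eq matrix_vector_mul_assoc[symmetric]
    using projection_range[OF Q] eq by blast
  moreover have "P ** Q = Q"
    unfolding matrix_eq matrix_vector_mul_assoc[symmetric]
    using projection_range[OF P] eq by blast
  ultimately show ?thesis using P Q by (metis hermitian_def madj_mult projection_def)
qed

lemma psd_id_minus_projection:
  assumes "projection P"
  shows "psd (mat 1 - P)"
proof -
  have "hermitian (mat 1 - P)" using assms by (simp add: projection_def hermitian_def)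
  then have "psd ((mat 1 - P) ** mat 1 ** (mat 1 - P))" by (intro psd_conj_hermitian psd_mat_1)
  then show ?thesis using assms by (simp add: projection_def mm.diff_left mm.diff_right)
qed

lemma projection_fixpoint:
  assumes P: "projection P" and v: "v \<bullet> (P *v v) = v \<bullet> v"
  shows "P *v v = v"
proof -
  have "(mat 1 - P) *v v = 0"
    by (rule psd_kernel[OF psd_id_minus_projection[OF P]]) (simp add: mv.diff_left inner_diff_right v)
  then show ?thesis by (simp add: mv.diff_left)
qed

lemma projection_inner_le: "projection P \<Longrightarrow> v \<bullet> (P *v v) \<le> v \<bullet> v"
  using psd_id_minus_projection[of P] by (simp add: psd_iff mv.diff_left inner_diff_right)

lemma projection_fixspace:
  assumes "hermitian S"
  shows "projection (matfun (\<lambda>x. if x = 1 then 1 else 0) S)" (is "projection ?R")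
    and "range ((*v) (matfun (\<lambda>x. if x = 1 then 1 else 0) S)) = {v. S *v v = v}"
proof -
  have "?R ** ?R = ?R"
    unfolding matfun_mult[OF assms] by (rule arg_cong[where f = "\<lambda>f. matfun f S"]) auto
  then show P: "projection ?R" by (simp add: projection_def assms)
  have "S ** ?R = matfun (\<lambda>x. x) S ** ?R" by (simp add: matfun_ident assms)
  also have "\<dots> = ?R"
    unfolding matfun_mult[OF assms] by (rule arg_cong[where f = "\<lambda>f. matfun f S"]) auto
  finally have SR: "S ** ?R = ?R" .
  show "range ((*v) ?R) = {v. S *v v = v}"
  proof (intro equalityI subsetI)
    fix v assume "v \<in> range ((*v) ?R)"
    then show "v \<in> {v. S *v v = v}" by (auto simp: matrix_vector_mul_assoc SR)
  next
    fix v assume "v \<in> {v. S *v v = v}"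
    then have "?R *v v = v" using eigenvector_matfun[OF assms, of v 1 "\<lambda>x. if x = 1 then 1 else 0"] by simp
    then show "v \<in> range ((*v) ?R)" by (metis rangeI)
  qed
qed

text \<open>Turns the meet into a spectral projection of any suitable \<open>S\<close>, so every
  mean can bring its own zeroth-order limit.\<close>

lemma proj_meet_eqI:
  assumes S: "hermitian S" and eq: "\<And>v. S *v v = v \<longleftrightarrow> P *v v = v \<and> Q *v v = v"
    and P: "projection P" and Q: "projection Q"
  shows "proj_meet P Q = matfun (\<lambda>x. if x = 1 then 1 else 0) S"
proof -
  let ?R = "matfun (\<lambda>x. if x = 1 then 1 else 0) S"
  have R: "range ((*v) ?R) = range ((*v) P) \<inter> range ((*v) Q)"
    unfolding projection_fixspace(2)[OF S] projection_range[OF P] projection_range[OF Q] using eq by auto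
  show ?thesis
    unfolding proj_meet_def
  proof (rule the_equality)
    show "hermitian ?R \<and> ?R ** ?R = ?R \<and> range ((*v) ?R) = range ((*v) P) \<inter> range ((*v) Q)"
      using projection_fixspace(1)[OF S] R by (simp add: projection_def)
  next
    fix R' assume "hermitian R' \<and> R' ** R' = R' \<and> range ((*v) R') = range ((*v) P) \<inter> range ((*v) Q)"
    then show "R' = ?R"
      using R projection_fixspace(1)[OF S] by (intro projection_unique) (auto simp: projection_def)
  qed
qed

text \<open>A fixed vector forces equality in both bounds
  \<open>v \<bullet> (P *v v) \<le> v \<bullet> v\<close> and its analogue for \<open>Q\<close>.
  Serves the arithmetic mean.\<close>

lemma convex_combination_fixpoint:
  assumes P: "projection P" and Q: "projection Q" and \<alpha>: "0 < \<alpha>" "\<alpha> < 1"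
  shows "((1 - \<alpha>) *\<^sub>R P + \<alpha> *\<^sub>R Q) *v v = v \<longleftrightarrow> P *v v = v \<and> Q *v v = v"
proof
  assume "((1 - \<alpha>) *\<^sub>R P + \<alpha> *\<^sub>R Q) *v v = v"
  then have "v \<bullet> v = v \<bullet> (((1 - \<alpha>) *\<^sub>R P + \<alpha> *\<^sub>R Q) *v v)" by simp
  also have "\<dots> = (1 - \<alpha>) * (v \<bullet> (P *v v)) + \<alpha> * (v \<bullet> (Q *v v))"
    by (simp add: mv.add_left mv.scaleR_left inner_add_right)
  finally have "(1 - \<alpha>) * (v \<bullet> v - v \<bullet> (P *v v)) + \<alpha> * (v \<bullet> v - v \<bullet> (Q *v v)) = 0"
    by (simp add: algebra_simps)
  moreover have "0 \<le> (1 - \<alpha>) * (v \<bullet> v - v \<bullet> (P *v v))" "0 \<le> \<alpha> * (v \<bullet> v - v \<bullet> (Q *v v))"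
    using \<alpha> projection_inner_le[OF P, of v] projection_inner_le[OF Q, of v] by auto
  ultimately have "(1 - \<alpha>) * (v \<bullet> v - v \<bullet> (P *v v)) = 0" "\<alpha> * (v \<bullet> v - v \<bullet> (Q *v v)) = 0"
    by linarith+
  then have "v \<bullet> (P *v v) = v \<bullet> v" "v \<bullet> (Q *v v) = v \<bullet> v" using \<alpha> by auto
  then show "P *v v = v \<and> Q *v v = v" using projection_fixpoint P Q by blast
next
  assume "P *v v = v \<and> Q *v v = v"
  then show "((1 - \<alpha>) *\<^sub>R P + \<alpha> *\<^sub>R Q) *v v = v"
    by (simp add: mv.add_left mv.scaleR_left flip: scaleR_add_left)
qed

text \<open>The outer factor gives \<open>P *v v = v\<close>; the form of \<open>Q\<close> at
  \<open>v\<close> then attains its maximum. Serves the mean \<open>meanR\<close>.\<close>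

lemma compression_fixpoint:
  assumes P: "projection P" and Q: "projection Q"
  shows "(P ** Q ** P) *v v = v \<longleftrightarrow> P *v v = v \<and> Q *v v = v"
proof
  assume v: "(P ** Q ** P) *v v = v"
  then have Pv: "P *v v = v" using P by (metis matrix_vector_mul_assoc projection_def)
  have "v \<bullet> (Q *v v) = (P *v v) \<bullet> (Q *v (P *v v))" by (simp add: Pv)
  also have "\<dots> = v \<bullet> ((P ** Q ** P) *v v)"
    using P by (simp add: projection_def hermitian_inner matrix_vector_mul_assoc matrix_mul_assoc)
  also have "\<dots> = v \<bullet> v" by (simp add: v)
  finally show "P *v v = v \<and> Q *v v = v" using Pv projection_fixpoint[OF Q] by blast
qed (simp add: matrix_vector_mul_assoc[symmetric])

lemma supp_facts:
  assumes "psd A"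
  shows "projection (supp A)" "A ** supp A = A" "supp (ginv A) = supp A" "mlog (ginv A) = - mlog A"
    "psd (ginv A)"
proof -
  note h = psd_hermitian[OF assms]
  show "projection (supp A)"
    unfolding projection_def supp_def matfun_mult[OF h]
    by (auto simp: h intro!: arg_cong[where f = "\<lambda>f. matfun f A"])
  have "matfun (\<lambda>x. x) A ** supp A = matfun (\<lambda>x. x) A"
    unfolding supp_def matfun_mult[OF h] by (rule arg_cong[where f = "\<lambda>f. matfun f A"]) auto
  then show "A ** supp A = A" by (simp only: matfun_ident[OF h])
  show "supp (ginv A) = supp A"
    unfolding supp_def ginv_def matfun_compose[OF h] by (rule arg_cong[where f = "\<lambda>f. matfun f A"]) auto
  have "mlog (ginv A) = (-1) *\<^sub>R mlog A"
    unfolding mlog_def ginv_def matfun_compose[OF h] matfun_scaleR[OF h]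
    by (rule matfun_cong[OF assms]) (auto simp: ln_div)
  then show "mlog (ginv A) = - mlog A" by simp
  show "psd (ginv A)" unfolding ginv_def by (rule psd_matfun[OF assms]) auto
qed

lemma mpow_facts:
  assumes "psd A" and p: "0 < p"
  shows "psd (mpow A p)" "supp (mpow A p) = supp A" "ginv (mpow A p) = mpow (ginv A) p"
proof -
  note h = psd_hermitian[OF assms(1)]
  show "psd (mpow A p)" unfolding mpow_def by (rule psd_matfun[OF assms(1)]) auto
  show "supp (mpow A p) = supp A"
    unfolding supp_def mpow_def matfun_compose[OF h] by (rule arg_cong[where f = "\<lambda>f. matfun f A"]) auto
  show "ginv (mpow A p) = mpow (ginv A) p"
    unfolding ginv_def mpow_def matfun_compose[OF h]
    by (rule matfun_cong[OF assms(1)]) (auto simp: powr_divide)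
qed

subsection \<open>First-order expansions at \<open>p = 0\<close>\<close>

text \<open>A right derivative at 0 in which \<open>S\<close> stands in for \<open>F 0\<close>; the value \<open>F 0\<close> itself is irrelevant.\<close>

definition rderiv0 :: "(real \<Rightarrow> 'n::finite cmat) \<Rightarrow> 'n cmat \<Rightarrow> 'n cmat \<Rightarrow> bool" where
  "rderiv0 F S D \<longleftrightarrow> ((\<lambda>p. (1 / p) *\<^sub>R (F p - S)) \<longlongrightarrow> D) (at_right 0)"

lemma eventually_at_right_0I: "(\<And>p::real. 0 < p \<Longrightarrow> R p) \<Longrightarrow> \<forall>\<^sub>F p in at_right 0. R p"
  by (rule eventually_mono[OF eventually_at_right_less[of "0::real"]])

lemma rderiv0_const: "rderiv0 (\<lambda>p. S) S 0"
  by (simp add: rderiv0_def)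

lemma rderiv0_add: "rderiv0 F S D \<Longrightarrow> rderiv0 G T E \<Longrightarrow> rderiv0 (\<lambda>p. F p + G p) (S + T) (D + E)"
  unfolding rderiv0_def by (drule (1) tendsto_add) (simp add: algebra_simps)

lemma rderiv0_scaleR: "rderiv0 F S D \<Longrightarrow> rderiv0 (\<lambda>p. c *\<^sub>R F p) (c *\<^sub>R S) (c *\<^sub>R D)"
  unfolding rderiv0_def by (drule tendsto_scaleR[OF tendsto_const, of _ _ _ c]) (simp add: algebra_simps)

lemma rderiv0_tendsto:
  assumes "rderiv0 F S D"
  shows "(F \<longlongrightarrow> S) (at_right 0)"
proof -
  have "((\<lambda>p. p *\<^sub>R ((1 / p) *\<^sub>R (F p - S)) + S) \<longlongrightarrow> 0 *\<^sub>R D + S) (at_right 0)"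
    using assms unfolding rderiv0_def by (intro tendsto_intros)
  then have "((\<lambda>p. p *\<^sub>R ((1 / p) *\<^sub>R (F p - S)) + S) \<longlongrightarrow> S) (at_right 0)" by simp
  then show ?thesis
    by (rule Lim_transform_eventually) (rule eventually_at_right_0I, simp)
qed

lemma rderiv0_mult:
  assumes F: "rderiv0 F S D" and G: "rderiv0 G T E"
  shows "rderiv0 (\<lambda>p. F p ** G p) (S ** T) (D ** T + S ** E)"
proof -
  have "((\<lambda>p. (1 / p) *\<^sub>R (F p - S) ** G p + S ** ((1 / p) *\<^sub>R (G p - T))) \<longlongrightarrow> D ** T + S ** E) (at_right 0)"
    using F G unfolding rderiv0_def by (intro tendsto_add mm.tendsto rderiv0_tendsto[OF G] tendsto_const)
  moreover have "(1 / p) *\<^sub>R (F p - S) ** G p + S ** ((1 / p) *\<^sub>R (G p - T)) = (1 / p) *\<^sub>R (F p ** G p - S ** T)" for p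
    by (simp add: mm.scaleR_left mm.scaleR_right mm.diff_left mm.diff_right flip: scaleR_add_right)
  ultimately show ?thesis by (simp add: rderiv0_def)
qed

lemma rderiv0_mult_const:
  fixes P Q :: "'n::finite cmat"
  shows "rderiv0 F S D \<Longrightarrow> rderiv0 (\<lambda>p. P ** F p ** Q) (P ** S ** Q) (P ** D ** Q)"
  using rderiv0_mult[OF rderiv0_mult[OF rderiv0_const[of P]] rderiv0_const[of Q], of F S D] by simp

text \<open>At the eigenvalue 0 both the power and the support function are 0, so the quotient
  vanishes identically, in agreement with the value of \<open>mlog\<close> there.\<close>

lemma rderiv0_mpow:
  assumes A: "psd A" and c: "0 < c"
  shows "rderiv0 (\<lambda>p. mpow A (c * p)) (supp A) (c *\<^sub>R mlog A)"
proof -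
  note h = psd_hermitian[OF A]
  have "((\<lambda>p. (x powr (c * p) - 1) / p) \<longlongrightarrow> c * ln x) (at_right 0)" if x: "0 < x" for x
  proof -
    have "((\<lambda>p. x powr (c * p)) has_real_derivative c * ln x) (at 0)"
      using x by (auto intro!: derivative_eq_intros)
    then have "((\<lambda>p. (x powr (c * p) - 1) / p) \<longlongrightarrow> c * ln x) (at 0)"
      using x by (simp add: has_field_derivative_iff)
    then show ?thesis by (rule filterlim_mono) (auto simp: at_le)
  qed
  then have "((\<lambda>p. matfun (\<lambda>x. (1 / p) * (x powr (c * p) - (if x = 0 then 0 else 1))) A) \<longlongrightarrow>
     matfun (\<lambda>x. c * (if x = 0 then 0 else ln x)) A) (at_right 0)"
    by (intro matfun_tendsto_pointwise[OF A]) auto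
  then show ?thesis
    unfolding rderiv0_def mpow_def supp_def mlog_def matfun_diff[OF h] matfun_scaleR[OF h] .
qed

lemma rderiv0_squeeze:
  assumes "\<And>p. 0 < p \<Longrightarrow> psd (X p - F p)" "\<And>p. 0 < p \<Longrightarrow> psd (H p - X p)"
    and "rderiv0 F S D" "rderiv0 H S D"
  shows "rderiv0 X S D"
  unfolding rderiv0_def
proof (rule psd_squeeze)
  have "psd ((1 / p) *\<^sub>R (X p - F p))" "psd ((1 / p) *\<^sub>R (H p - X p))" if "0 < p" for p
    using assms(1,2) that by (auto intro: psd_scaleR)
  then show "\<forall>\<^sub>F p in at_right 0. psd ((1 / p) *\<^sub>R (X p - S) - (1 / p) *\<^sub>R (F p - S))"
    and "\<forall>\<^sub>F p in at_right 0. psd ((1 / p) *\<^sub>R (H p - S) - (1 / p) *\<^sub>R (X p - S))"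
    by (auto intro!: eventually_at_right_0I simp flip: scaleR_diff_right)
qed (use assms(3,4) in \<open>auto simp: rderiv0_def\<close>)

lemma proj_meet_facts:
  assumes P: "projection P" and Q: "projection Q"
  shows "projection (proj_meet P Q)"
    "P ** proj_meet P Q = proj_meet P Q" "Q ** proj_meet P Q = proj_meet P Q"
    "proj_meet P Q ** P = proj_meet P Q" "proj_meet P Q ** Q = proj_meet P Q"
    "\<And>v. P *v v = v \<Longrightarrow> Q *v v = v \<Longrightarrow> proj_meet P Q *v v = v"
proof -
  \<comment> \<open>The midpoint is merely a convenient Hermitian matrix with the right fixed
    vectors; it shows that the description in \<open>proj_meet\<close> has a value.\<close>
  let ?S = "(1 - 1/2) *\<^sub>R P + (1/2) *\<^sub>R Q"
  have fp: "?S *v v = v \<longleftrightarrow> P *v v = v \<and> Q *v v = v" for v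
    by (rule convex_combination_fixpoint[OF P Q]) auto
  have hS: "hermitian ?S" using P Q by (simp add: projection_def hermitian_def)
  have eq: "proj_meet P Q = matfun (\<lambda>x. if x = 1 then 1 else 0) ?S"
    by (rule proj_meet_eqI[OF hS fp P Q])
  show pr: "projection (proj_meet P Q)" unfolding eq by (rule projection_fixspace(1)[OF hS])
  have range: "range ((*v) (proj_meet P Q)) = {v. P *v v = v \<and> Q *v v = v}"
    unfolding eq projection_fixspace(2)[OF hS] fp ..
  show "proj_meet P Q *v v = v" if "P *v v = v" "Q *v v = v" for v
    using range projection_range[OF pr] that by blast
  show 1: "P ** proj_meet P Q = proj_meet P Q" "Q ** proj_meet P Q = proj_meet P Q"
    unfolding matrix_eq matrix_vector_mul_assoc[symmetric] using range by blast+
  show "proj_meet P Q ** P = proj_meet P Q" "proj_meet P Q ** Q = proj_meet P Q"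
    using 1 pr P Q by (metis hermitian_def madj_mult projection_def)+
qed

text \<open>The kernel clause gives \<open>X p = P ** X p ** P\<close>, so both bounds may be
  compressed. After compression each has zeroth-order term \<open>P\<close> and the same slope, and
  the squeeze applies.\<close>

lemma between_means_rderiv0:
  fixes A B :: "'n::finite cmat"
  assumes \<alpha>: "0 < \<alpha>" "\<alpha> < 1" and A: "psd A" and B: "psd B"
    and X: "\<And>p. 0 < p \<Longrightarrow> between_means \<alpha> (mpow A p) (mpow B p) (X p)"
  defines "P \<equiv> proj_meet (supp A) (supp B)"
  shows "0 < p \<Longrightarrow> P ** X p = X p" "0 < p \<Longrightarrow> X p ** P = X p"
    "rderiv0 X P ((1 - \<alpha>) *\<^sub>R (P ** mlog A ** P) + \<alpha> *\<^sub>R (P ** mlog B ** P))"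
proof -
  note sA = supp_facts[OF A] and sB = supp_facts[OF B]
  note P = proj_meet_facts[OF sA(1) sB(1), folded P_def]
  have hP: "hermitian P" and PP: "P ** P = P" using P(1) by (auto simp: projection_def)
  have psdX: "psd (X p)" if "0 < p" for p using X[OF that] by (simp add: between_means_def)
  show PX: "P ** X p = X p" if p: "0 < p" for p
  proof -
    \<comment> \<open>\<open>mat 1 - supp C\<close> maps into the kernel of \<open>mpow C p\<close>,
      hence into that of \<open>X p\<close>; taking adjoints moves the support to the left.\<close>
    have supp_left: "supp C ** X p = X p"
      if C: "psd C" and ker: "\<And>v. mpow C p *v v = 0 \<Longrightarrow> X p *v v = 0" for C
    proof -
      have "mpow C p ** (mat 1 - supp C) = 0"
        using supp_facts(2)[OF mpow_facts(1)[OF C p]] mpow_facts(2)[OF C p] by (simp add: mm.diff_right)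
      then have "X p *v ((mat 1 - supp C) *v v) = 0" for v
        by (intro ker) (simp add: matrix_vector_mul_assoc)
      then have "X p ** (mat 1 - supp C) = 0" by (simp add: matrix_eq matrix_vector_mul_assoc)
      then have "X p ** supp C = X p" by (simp add: mm.diff_right)
      then show ?thesis
        using psd_hermitian[OF psdX[OF p]] supp_facts(1)[OF C] by (metis hermitian_def madj_mult projection_def)
    qed
    have "supp A ** X p = X p" "supp B ** X p = X p"
      using supp_left A B X[OF p] unfolding between_means_def by blast+
    then have "P *v (X p *v v) = X p *v v" for v
      by (intro P(6)) (simp_all add: matrix_vector_mul_assoc)
    then show ?thesis by (simp add: matrix_eq matrix_vector_mul_assoc)
  qed
  show XP: "X p ** P = X p" if p: "0 < p" for p
    using PX[OF p] hP psd_hermitian[OF psdX[OF p]] by (metis hermitian_def madj_mult)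
  have dA: "rderiv0 (\<lambda>p. mpow A p) (supp A) (mlog A)" and dB: "rderiv0 (\<lambda>p. mpow B p) (supp B) (mlog B)"
    using rderiv0_mpow[OF A, of 1] rderiv0_mpow[OF B, of 1] by simp_all
  have diA: "rderiv0 (\<lambda>p. mpow (ginv A) p) (supp A) (- mlog A)"
    and diB: "rderiv0 (\<lambda>p. mpow (ginv B) p) (supp B) (- mlog B)"
    using rderiv0_mpow[OF sA(5), of 1] rderiv0_mpow[OF sB(5), of 1] by (simp_all add: sA sB)
  have comp: "P ** supp A ** P = P" "P ** supp B ** P = P" by (simp_all add: P(4,5) PP)
  let ?K = "(1 - \<alpha>) *\<^sub>R (P ** mlog A ** P) + \<alpha> *\<^sub>R (P ** mlog B ** P)"
  show "rderiv0 X P ?K"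
  proof (rule rderiv0_squeeze)
    let ?H = "\<lambda>p. (1 - \<alpha>) *\<^sub>R (P ** mpow A p ** P) + \<alpha> *\<^sub>R (P ** mpow B p ** P)"
    \<comment> \<open>At zeroth order \<open>2 *\<^sub>R P\<close> minus a weighted average of
      copies of \<open>P\<close> is \<open>P\<close>; at first order the negative weights meet the
      slopes \<open>- mlog A\<close> and \<open>- mlog B\<close>, and the signs cancel.\<close>
    let ?F = "\<lambda>p. 2 *\<^sub>R P + ((- (1 - \<alpha>)) *\<^sub>R (P ** mpow (ginv A) p ** P) + (- \<alpha>) *\<^sub>R (P ** mpow (ginv B) p ** P))"
    have "rderiv0 ?F (2 *\<^sub>R P + ((- (1 - \<alpha>)) *\<^sub>R (P ** supp A ** P) + (- \<alpha>) *\<^sub>R (P ** supp B ** P)))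
       (0 + ((- (1 - \<alpha>)) *\<^sub>R (P ** (- mlog A) ** P) + (- \<alpha>) *\<^sub>R (P ** (- mlog B) ** P)))"
      by (intro rderiv0_add rderiv0_scaleR rderiv0_mult_const diA diB rderiv0_const)
    also have "2 *\<^sub>R P + ((- (1 - \<alpha>)) *\<^sub>R (P ** supp A ** P) + (- \<alpha>) *\<^sub>R (P ** supp B ** P)) = P"
      by (simp add: comp algebra_simps scaleR_2)
    also have "0 + ((- (1 - \<alpha>)) *\<^sub>R (P ** (- mlog A) ** P) + (- \<alpha>) *\<^sub>R (P ** (- mlog B) ** P)) = ?K"
      by (simp add: mm.minus_left mm.minus_right algebra_simps)
    finally show "rderiv0 ?F P ?K" .
    have "rderiv0 ?H ((1 - \<alpha>) *\<^sub>R (P ** supp A ** P) + \<alpha> *\<^sub>R (P ** supp B ** P)) ?K"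
      by (intro rderiv0_add rderiv0_scaleR rderiv0_mult_const dA dB)
    also have "(1 - \<alpha>) *\<^sub>R (P ** supp A ** P) + \<alpha> *\<^sub>R (P ** supp B ** P) = P"
      by (simp add: comp flip: scaleR_add_left)
    finally show "rderiv0 ?H P ?K" .
    fix p :: real assume p: "0 < p"
    have XPX: "P ** X p ** P = X p" by (simp add: PX XP p)
    have "psd (P ** ((1 - \<alpha>) *\<^sub>R mpow A p + \<alpha> *\<^sub>R mpow B p - X p) ** P)"
      using X[OF p] by (intro psd_conj_hermitian hP) (simp add: between_means_def)
    then show "psd (?H p - X p)"
      by (simp add: mm.add_left mm.add_right mm.diff_left mm.diff_right mm.scaleR_left mm.scaleR_right XPX)
    have "psd (P ** X p ** P - (2 *\<^sub>R P - (1 - \<alpha>) *\<^sub>R (P ** ginv (mpow A p) ** P) - \<alpha> *\<^sub>R (P ** ginv (mpow B p) ** P)))"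
      using X[OF p] hP PP P(2,3) unfolding between_means_def mpow_facts(2)[OF A p] mpow_facts(2)[OF B p] by blast
    also have "P ** X p ** P - (2 *\<^sub>R P - (1 - \<alpha>) *\<^sub>R (P ** ginv (mpow A p) ** P) - \<alpha> *\<^sub>R (P ** ginv (mpow B p) ** P)) = X p - ?F p"
      unfolding XPX mpow_facts(3)[OF A p] mpow_facts(3)[OF B p] by (simp add: algebra_simps)
    finally show "psd (X p - ?F p)" .
  qed
qed

text \<open>
  Both bounds touch \<open>x powr a\<close> to first order at 1. The lower one also holds at 0 without a
  constant term, so that it survives the functional calculus of singular matrices.
\<close>

lemma powr_quadratic_bounds:
  fixes x a :: real
  assumes a: "0 < a" "a < 1" and x: "0 \<le> x"
  shows "(2 - a) * x - (1 - a) * (x * x) \<le> x powr a" "x powr a \<le> a * x + (1 - a)"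
proof -
  show "x powr a \<le> a * x + (1 - a)" using young_powr[OF a, of 1 x] x by simp
  show "(2 - a) * x - (1 - a) * (x * x) \<le> x powr a"
  proof (cases "x = 0")
    case False
    then have x0: "0 < x" using x by simp
    \<comment> \<open>The tangent at 1 bounds \<open>x powr (a - 1)\<close> from below; multiplying
      by \<open>x\<close> removes the constant term.\<close>
    have "1 + (a - 1) * (x - 1) \<le> 1 + (a - 1) * ln x"
      using a ln_le_minus_one[OF x0] by (simp add: mult_left_mono_neg)
    also have "\<dots> \<le> exp ((a - 1) * ln x)" by (rule exp_ge_add_one_self)
    also have "\<dots> = x powr (a - 1)" using x0 by (simp add: powr_def)
    finally have "x * (1 + (a - 1) * (x - 1)) \<le> x * x powr (a - 1)" using x by (rule mult_left_mono)
    also have "x * x powr (a - 1) = x powr a" using x0 by (simp add: powr_diff)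
    finally show ?thesis by (simp add: algebra_simps)
  qed simp
qed

text \<open>\<open>x powr a\<close> has infinite slope at 0, so the power cannot simply be
  differentiated at the singular \<open>P\<close>. On the range of \<open>P\<close>, however,
  \<open>C p\<close> is near the identity, and the quadratic bounds squeeze it; the constant
  \<open>1 - a\<close> of the upper one becomes a multiple of \<open>P\<close> by
  compression.\<close>

lemma rderiv0_mpow_projection:
  fixes C :: "real \<Rightarrow> 'n::finite cmat"
  assumes a: "0 < a" "a < 1" and P: "projection P"
    and C: "\<And>p. 0 < p \<Longrightarrow> psd (C p)" "\<And>p. 0 < p \<Longrightarrow> P ** C p = C p" "\<And>p. 0 < p \<Longrightarrow> C p ** P = C p"
    and D: "rderiv0 C P L" and L: "P ** L = L" "L ** P = L"
  shows "rderiv0 (\<lambda>p. mpow (C p) a) P (a *\<^sub>R L)"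
proof -
  have hP: "hermitian P" and PP: "P ** P = P" using P by (auto simp: projection_def)
  \<comment> \<open>The range of \<open>mat 1 - P\<close> lies in the kernel of \<open>C p\<close>,
    and \<open>0 powr a = 0\<close> keeps it in the kernel of the power.\<close>
  have right: "mpow (C p) a ** P = mpow (C p) a" if p: "0 < p" for p
  proof -
    have "C p *v ((mat 1 - P) *v v) = 0 *\<^sub>R ((mat 1 - P) *v v)" for v
      by (simp add: matrix_vector_mul_assoc mm.diff_right C(3) p)
    from eigenvector_matfun[OF psd_hermitian[OF C(1)[OF p]] this]
    have "mpow (C p) a ** (mat 1 - P) = 0"
      by (simp add: mpow_def matrix_eq matrix_vector_mul_assoc)
    then show ?thesis by (simp add: mm.diff_right)
  qed
  have left: "P ** mpow (C p) a = mpow (C p) a" if p: "0 < p" for p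
    using right[OF p] hP psd_hermitian[OF mpow_facts(1)[OF C(1)[OF p] a(1)]]
    by (metis hermitian_def madj_mult)
  show ?thesis
  proof (rule rderiv0_squeeze)
    let ?H = "\<lambda>p. a *\<^sub>R C p + (1 - a) *\<^sub>R P"
    let ?F = "\<lambda>p. (2 - a) *\<^sub>R C p + (- (1 - a)) *\<^sub>R (C p ** C p)"
    have "rderiv0 ?F ((2 - a) *\<^sub>R P + (- (1 - a)) *\<^sub>R (P ** P)) ((2 - a) *\<^sub>R L + (- (1 - a)) *\<^sub>R (L ** P + P ** L))"
      by (intro rderiv0_add rderiv0_scaleR rderiv0_mult D)
    also have "(2 - a) *\<^sub>R P + (- (1 - a)) *\<^sub>R (P ** P) = P" by (simp only: PP flip: scaleR_add_left) simp
    also have "(2 - a) *\<^sub>R L + (- (1 - a)) *\<^sub>R (L ** P + P ** L) = a *\<^sub>R L"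
      unfolding L scaleR_2[symmetric] scaleR_scaleR scaleR_add_left[symmetric] by simp
    finally show "rderiv0 ?F P (a *\<^sub>R L)" .
    have "rderiv0 ?H (a *\<^sub>R P + (1 - a) *\<^sub>R P) (a *\<^sub>R L + (1 - a) *\<^sub>R 0)"
      by (intro rderiv0_add rderiv0_scaleR D rderiv0_const)
    also have "a *\<^sub>R P + (1 - a) *\<^sub>R P = P" by (simp flip: scaleR_add_left)
    finally show "rderiv0 ?H P (a *\<^sub>R L)" by simp
    fix p :: real assume p: "0 < p"
    note h = psd_hermitian[OF C(1)[OF p]]
    have "psd (matfun (\<lambda>x. x powr a - ((2 - a) * x + (- (1 - a)) * (x * x))) (C p))"
      by (rule psd_matfun[OF C(1)[OF p]]) (use powr_quadratic_bounds(1)[OF a] in \<open>simp add: algebra_simps\<close>)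
    then show "psd (mpow (C p) a - ?F p)"
      by (simp only: mpow_def matfun_diff[OF h, symmetric] matfun_add[OF h, symmetric] matfun_scaleR[OF h, symmetric]
          matfun_mult[OF h, symmetric] matfun_ident[OF h])
    have "psd (matfun (\<lambda>x. a * x + (1 - a) * 1 - x powr a) (C p))"
      by (rule psd_matfun[OF C(1)[OF p]]) (use powr_quadratic_bounds(2)[OF a] in simp)
    also have "matfun (\<lambda>x. a * x + (1 - a) * 1 - x powr a) (C p) = a *\<^sub>R C p + (1 - a) *\<^sub>R mat 1 - mpow (C p) a"
      by (simp only: mpow_def matfun_diff[OF h, symmetric] matfun_add[OF h, symmetric] matfun_scaleR[OF h, symmetric]
          matfun_one[OF h] matfun_ident[OF h])
    finally have "psd (P ** (a *\<^sub>R C p + (1 - a) *\<^sub>R mat 1 - mpow (C p) a) ** P)"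
      by (rule psd_conj_hermitian[OF _ hP])
    also have "P ** (a *\<^sub>R C p + (1 - a) *\<^sub>R mat 1 - mpow (C p) a) ** P = ?H p - mpow (C p) a"
      by (simp add: mm.add_left mm.add_right mm.diff_left mm.diff_right mm.scaleR_left mm.scaleR_right PP C(2,3) p left right)
    finally show "psd (?H p - mpow (C p) a)" .
  qed
qed

text \<open>As the meet absorbs \<open>S\<close>, the expansion around \<open>S\<close> yields on
  its rows the expansion around \<open>mat 1\<close> that \<open>mpow_inverse_tendsto\<close> asks
  for.\<close>

lemma mpow_inverse_tendsto_proj_meet:
  fixes X :: "real \<Rightarrow> 'n::finite cmat"
  assumes P: "projection P" and Q: "projection Q"
    and X: "\<And>p. 0 < p \<Longrightarrow> psd (X p)" and D: "rderiv0 X S D"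
    and S: "hermitian S" "psd (mat 1 - S)" "\<And>v. S *v v = v \<longleftrightarrow> P *v v = v \<and> Q *v v = v"
    and K: "proj_meet P Q ** D ** proj_meet P Q = K"
  shows "((\<lambda>p. mpow (X p) (1 / p)) \<longlongrightarrow> proj_meet P Q ** mexp K) (at_right 0)"
proof -
  let ?R = "proj_meet P Q"
  have eq: "?R = matfun (\<lambda>x. if x = 1 then 1 else 0) S"
    by (rule proj_meet_eqI[OF S(1,3) P Q])
  have "S *v (?R *v v) = ?R *v v" for v
    using projection_fixspace(2)[OF S(1)] unfolding eq by blast
  then have "S ** ?R = ?R" by (simp add: matrix_eq matrix_vector_mul_assoc)
  then have RS: "?R ** S = ?R"
    using S(1) proj_meet_facts(1)[OF P Q] by (metis hermitian_def madj_mult projection_def)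
  have "((\<lambda>p. ?R ** ((1 / p) *\<^sub>R (X p - S))) \<longlongrightarrow> ?R ** D) (at_right 0)"
    using D unfolding rderiv0_def by (intro mm.tendsto tendsto_const)
  moreover have "?R ** ((1 / p) *\<^sub>R (X p - S)) = (1 / p) *\<^sub>R (?R ** (X p - mat 1))" for p
    by (simp add: mm.scaleR_right mm.diff_right RS)
  ultimately have "((\<lambda>p. (1 / p) *\<^sub>R (?R ** (X p - mat 1))) \<longlongrightarrow> ?R ** D) (at_right 0)" by simp
  from mpow_inverse_tendsto[OF X rderiv0_tendsto[OF D] S(2) eq this] show ?thesis by (simp add: K)
qed

lemma proj_meet_fixpoint_iff:
  assumes "projection P" "projection Q"
  shows "proj_meet P Q *v v = v \<longleftrightarrow> P *v v = v \<and> Q *v v = v"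
  using proj_meet_facts[OF assms] by (metis matrix_vector_mul_assoc)

subsection \<open>The limits\<close>

context
  fixes A B :: "'n::finite cmat" and \<alpha> :: real
  assumes \<alpha>: "0 < \<alpha>" "\<alpha> < 1" and A: "psd A" and B: "psd B"
begin

abbreviation (input) "P0 \<equiv> proj_meet (supp A) (supp B)"

lemma P0_facts:
  "projection P0" "hermitian P0" "P0 ** P0 = P0"
  "supp A ** P0 = P0" "supp B ** P0 = P0" "P0 ** supp A = P0" "P0 ** supp B = P0"
  using proj_meet_facts[OF supp_facts(1)[OF A] supp_facts(1)[OF B]] by (auto simp: projection_def)

lemma P0_cancel:
  "P0 ** (P0 ** M) = P0 ** M" "supp A ** (P0 ** M) = P0 ** M" "supp B ** (P0 ** M) = P0 ** M"
  "P0 ** (supp A ** M) = P0 ** M" "P0 ** (supp B ** M) = P0 ** M"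
  by (simp_all add: matrix_mul_assoc P0_facts)

lemma LE_eq: "LE \<alpha> A B = P0 ** mexp ((1 - \<alpha>) *\<^sub>R (P0 ** mlog A ** P0) + \<alpha> *\<^sub>R (P0 ** mlog B ** P0))"
  by (simp add: LE_def Let_def)

lemma meanA_tendsto: "((\<lambda>p. meanA \<alpha> p A B) \<longlongrightarrow> LE \<alpha> A B) (at_right 0)"
  unfolding meanA_def LE_eq
proof (rule mpow_inverse_tendsto_proj_meet)
  note pA = supp_facts(1)[OF A] and pB = supp_facts(1)[OF B]
  let ?S = "(1 - \<alpha>) *\<^sub>R supp A + \<alpha> *\<^sub>R supp B"
  show "projection (supp A)" "projection (supp B)" by (fact pA pB)+
  show "psd ((1 - \<alpha>) *\<^sub>R mpow A p + \<alpha> *\<^sub>R mpow B p)" if "0 < p" for p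
    using \<alpha> mpow_facts(1)[OF A that] mpow_facts(1)[OF B that] by (intro psd_add psd_scaleR) auto
  show "rderiv0 (\<lambda>p. (1 - \<alpha>) *\<^sub>R mpow A p + \<alpha> *\<^sub>R mpow B p) ?S ((1 - \<alpha>) *\<^sub>R mlog A + \<alpha> *\<^sub>R mlog B)"
    using rderiv0_mpow[OF A, of 1] rderiv0_mpow[OF B, of 1] by (intro rderiv0_add rderiv0_scaleR) simp_all
  show "hermitian ?S" using pA pB by (simp add: projection_def hermitian_def)
  have "psd ((1 - \<alpha>) *\<^sub>R (mat 1 - supp A) + \<alpha> *\<^sub>R (mat 1 - supp B))"
    using \<alpha> by (intro psd_add psd_scaleR psd_id_minus_projection pA pB) auto
  then show "psd (mat 1 - ?S)" by (simp add: algebra_simps)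
  show "?S *v v = v \<longleftrightarrow> supp A *v v = v \<and> supp B *v v = v" for v
    by (rule convex_combination_fixpoint[OF pA pB \<alpha>])
qed (simp add: mm.add_left mm.add_right mm.scaleR_left mm.scaleR_right)

lemma meanR_tendsto: "((\<lambda>p. meanR \<alpha> p A B) \<longlongrightarrow> LE \<alpha> A B) (at_right 0)"
  unfolding meanR_def LE_eq
proof (rule mpow_inverse_tendsto_proj_meet)
  note pA = supp_facts(1)[OF A] and pB = supp_facts(1)[OF B]
  let ?c = "(1 - \<alpha>) / 2"
  let ?S = "supp A ** supp B ** supp A"
  let ?D = "((?c *\<^sub>R mlog A) ** supp B + supp A ** (\<alpha> *\<^sub>R mlog B)) ** supp A + (supp A ** supp B) ** (?c *\<^sub>R mlog A)"
  show "projection (supp A)" "projection (supp B)" by (fact pA pB)+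
  show "psd (mpow A (?c * p) ** mpow B (\<alpha> * p) ** mpow A (?c * p))" if "0 < p" for p
    using \<alpha> that by (intro psd_conj_hermitian mpow_facts(1) psd_hermitian[OF mpow_facts(1)] A B) auto
  show "rderiv0 (\<lambda>p. mpow A (?c * p) ** mpow B (\<alpha> * p) ** mpow A (?c * p)) ?S ?D"
    using \<alpha> by (intro rderiv0_mult rderiv0_mpow A B) auto
  show "hermitian ?S" using pA pB by (simp add: projection_def hermitian_def matrix_mul_assoc)
  \<comment> \<open>This sum of two semidefinite terms is \<open>mat 1 - ?S\<close>, by idempotence
    of \<open>supp A\<close>.\<close>
  have "psd (supp A ** (mat 1 - supp B) ** supp A + (mat 1 - supp A))"
    using pA pB by (intro psd_add psd_conj_hermitian psd_id_minus_projection) (auto simp: projection_def)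
  then show "psd (mat 1 - ?S)" using pA by (simp add: projection_def mm.diff_left mm.diff_right)
  show "?S *v v = v \<longleftrightarrow> supp A *v v = v \<and> supp B *v v = v" for v
    by (rule compression_fixpoint[OF pA pB])
  have "P0 ** ?D ** P0 = ?c *\<^sub>R (P0 ** mlog A ** P0) + \<alpha> *\<^sub>R (P0 ** mlog B ** P0) + ?c *\<^sub>R (P0 ** mlog A ** P0)"
    by (simp add: mm.add_left mm.add_right mm.scaleR_left mm.scaleR_right matrix_mul_assoc[symmetric] P0_facts P0_cancel)
  also have "\<dots> = (?c + ?c) *\<^sub>R (P0 ** mlog A ** P0) + \<alpha> *\<^sub>R (P0 ** mlog B ** P0)"
    unfolding scaleR_add_left by (simp only: add_ac)
  finally show "P0 ** ?D ** P0 = (1 - \<alpha>) *\<^sub>R (P0 ** mlog A ** P0) + \<alpha> *\<^sub>R (P0 ** mlog B ** P0)" by simp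
qed

lemma between_means_tendsto:
  assumes X: "\<And>p. 0 < p \<Longrightarrow> between_means \<alpha> (mpow A p) (mpow B p) (X p)"
  shows "((\<lambda>p. mpow (X p) (1 / p)) \<longlongrightarrow> LE \<alpha> A B) (at_right 0)"
  unfolding LE_eq
proof (rule mpow_inverse_tendsto_proj_meet)
  note pA = supp_facts(1)[OF A] and pB = supp_facts(1)[OF B]
  show "projection (supp A)" "projection (supp B)" by (fact pA pB)+
  show "psd (X p)" if "0 < p" for p using X[OF that] by (simp add: between_means_def)
  show "rderiv0 X P0 ((1 - \<alpha>) *\<^sub>R (P0 ** mlog A ** P0) + \<alpha> *\<^sub>R (P0 ** mlog B ** P0))"
    by (rule between_means_rderiv0(3)[OF \<alpha> A B X])
qed (simp_all add: P0_facts psd_id_minus_projection proj_meet_fixpoint_iff supp_facts(1) A B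
      mm.add_left mm.add_right mm.scaleR_left mm.scaleR_right matrix_mul_assoc[symmetric] P0_cancel)

text \<open>The compressed slope of the inner geometric mean is \<open>- (1 - b)\<close> times that
  of \<open>log A\<close> plus \<open>b\<close> times that of \<open>log B\<close>. It enters twice
  with factor \<open>a\<close>, and the middle power adds \<open>c\<close> times
  \<open>log A\<close>; the two equations in \<open>eq\<close> match coefficients with the
  Log-Euclidean exponent.\<close>

lemma sandwiched_mean_tendsto:
  assumes b: "0 < b" "b < 1" and a: "0 < a" "a < 1" and c: "0 < c"
    and eq: "2 * a * b = \<alpha>" "c - 2 * a * (1 - b) = 1 - \<alpha>"
  shows "((\<lambda>p. mpow (mpow (gmean b (mnpow A p) (mpow B p)) a ** mpow A (c * p) ** mpow (gmean b (mnpow A p) (mpow B p)) a) (1 / p))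
    \<longlongrightarrow> LE \<alpha> A B) (at_right 0)"
  unfolding LE_eq
proof (rule mpow_inverse_tendsto_proj_meet)
  note pA = supp_facts(1)[OF A] and pB = supp_facts(1)[OF B]
  note iA = supp_facts(3-5)[OF A]
  let ?C = "\<lambda>p. gmean b (mnpow A p) (mpow B p)"
  \<comment> \<open>\<open>L\<close> is the slope for the pair \<open>ginv A\<close>,
    \<open>B\<close>: inversion keeps the support, hence \<open>P0\<close>, and negates the
    logarithm.\<close>
  define L where "L = (- (1 - b)) *\<^sub>R (P0 ** mlog A ** P0) + b *\<^sub>R (P0 ** mlog B ** P0)"
  let ?D = "((a *\<^sub>R L) ** supp A + P0 ** (c *\<^sub>R mlog A)) ** P0 + (P0 ** supp A) ** (a *\<^sub>R L)"
  have bm: "between_means b (mpow (ginv A) p) (mpow B p) (?C p)" if "0 < p" for p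
    unfolding mnpow_def by (intro gmean_between_means b mpow_facts(1) iA B that)
  then have C: "psd (?C p)" if "0 < p" for p using that by (simp add: between_means_def)
  note r = between_means_rderiv0[OF b iA(3) B bm, unfolded iA(1,2)]
  have r3: "rderiv0 ?C P0 L" using r(3) by (simp add: L_def mm.minus_left mm.minus_right algebra_simps)
  have L: "P0 ** L = L" "L ** P0 = L"
    by (simp_all add: L_def mm.add_left mm.add_right mm.scaleR_left mm.scaleR_right matrix_mul_assoc[symmetric] P0_facts P0_cancel)
  have LM: "P0 ** (L ** M) = L ** M" for M by (simp add: matrix_mul_assoc L)
  have dC: "rderiv0 (\<lambda>p. mpow (?C p) a) P0 (a *\<^sub>R L)"
    by (rule rderiv0_mpow_projection[OF a P0_facts(1) C r(1) r(2) r3 L])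
  show "projection (supp A)" "projection (supp B)" by (fact pA pB)+
  show "psd (mpow (?C p) a ** mpow A (c * p) ** mpow (?C p) a)" if "0 < p" for p
    using that c a by (intro psd_conj_hermitian mpow_facts(1) psd_hermitian[OF mpow_facts(1)] A C) auto
  have "rderiv0 (\<lambda>p. mpow (?C p) a ** mpow A (c * p) ** mpow (?C p) a) (P0 ** supp A ** P0) ?D"
    by (intro rderiv0_mult dC rderiv0_mpow A c)
  then show "rderiv0 (\<lambda>p. mpow (?C p) a ** mpow A (c * p) ** mpow (?C p) a) P0 ?D" by (simp add: P0_facts)
  have "P0 ** ?D ** P0 = a *\<^sub>R L + c *\<^sub>R (P0 ** mlog A ** P0) + a *\<^sub>R L"
    by (simp only: mm.add_left mm.add_right mm.scaleR_left mm.scaleR_right matrix_mul_assoc[symmetric] P0_facts P0_cancel L LM)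
  also have "\<dots> = (c - 2 * a * (1 - b)) *\<^sub>R (P0 ** mlog A ** P0) + (2 * a * b) *\<^sub>R (P0 ** mlog B ** P0)"
    by (simp add: L_def algebra_simps flip: scaleR_2)
  finally show "P0 ** ?D ** P0 = (1 - \<alpha>) *\<^sub>R (P0 ** mlog A ** P0) + \<alpha> *\<^sub>R (P0 ** mlog B ** P0)"
    unfolding eq .
qed (simp_all add: P0_facts psd_id_minus_projection proj_meet_fixpoint_iff supp_facts(1) A B)

end

theorem theorem2p3:
  fixes A B :: "complex^'n::finite^'n" and \<alpha> :: real
  assumes "0 < \<alpha>" and "\<alpha> < 1" and "psd A" and "psd B"
  shows "((\<lambda>p. meanA \<alpha> p A B) \<longlongrightarrow> LE \<alpha> A B) (at_right 0) \<and>
         ((\<lambda>p. meanH \<alpha> p A B) \<longlongrightarrow> LE \<alpha> A B) (at_right 0) \<and>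
         ((\<lambda>p. meanG \<alpha> p A B) \<longlongrightarrow> LE \<alpha> A B) (at_right 0) \<and>
         ((\<lambda>p. meanR \<alpha> p A B) \<longlongrightarrow> LE \<alpha> A B) (at_right 0) \<and>
         (psd (supp A - supp B) \<longrightarrow>
            ((\<lambda>p. meanSG \<alpha> p A B) \<longlongrightarrow> LE \<alpha> A B) (at_right 0) \<and>
            ((\<lambda>p. meanSGt \<alpha> p A B) \<longlongrightarrow> LE \<alpha> A B) (at_right 0))"
proof (intro conjI impI)
  show "((\<lambda>p. meanA \<alpha> p A B) \<longlongrightarrow> LE \<alpha> A B) (at_right 0)" by (rule meanA_tendsto[OF assms])
  show "((\<lambda>p. meanR \<alpha> p A B) \<longlongrightarrow> LE \<alpha> A B) (at_right 0)" by (rule meanR_tendsto[OF assms])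
  show "((\<lambda>p. meanH \<alpha> p A B) \<longlongrightarrow> LE \<alpha> A B) (at_right 0)"
    unfolding meanH_def by (intro between_means_tendsto[OF assms] hmean_between_means mpow_facts(1) assms)
  show "((\<lambda>p. meanG \<alpha> p A B) \<longlongrightarrow> LE \<alpha> A B) (at_right 0)"
    unfolding meanG_def by (intro between_means_tendsto[OF assms] gmean_between_means mpow_facts(1) assms)
  show "((\<lambda>p. meanSG \<alpha> p A B) \<longlongrightarrow> LE \<alpha> A B) (at_right 0)"
    using sandwiched_mean_tendsto[OF assms, of "1/2" \<alpha> 1] assms by (simp add: meanSG_def Let_def)
  show "((\<lambda>p. meanSGt \<alpha> p A B) \<longlongrightarrow> LE \<alpha> A B) (at_right 0)"
    using sandwiched_mean_tendsto[OF assms, of \<alpha> "1/2" "2 * (1 - \<alpha>)"] assms by (simp add: meanSGt_def Let_def)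
qed

end
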